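(* Let $n\ge1$ and $\bm r\in\mathbb R^n$, and consider the passive generators on the canonical probe $|\psi_{\bm r}\rangle$. (i) For any mode pair $j<k$ for which both quadratures are identifiable, i.e. $F_{jk}^{\mathrm{bsX}}>0$ and $F_{jk}^{\mathrm{bsY}}>0$, the $2\times2$ tangent Gram matrix of $(\hat g_{jk}^{\mathrm{bsX}},\hat g_{jk}^{\mathrm{bsY}})$ has rank one, and the dimensionless incompatibility measure $R$ of this two-parameter model equals $1$. (ii) If $\bm r$ is regular, the largest dimension of a compatible real passive tangent subspace is $n(n+1)/2$.
   Context: Bosonic modes: on the Fock space of $n$ bosonic modes let $\hat a_j,\hat a_j^\dagger$ be the annihilation and creation operators, $[\hat a_j,\hat a_k^\dagger]=\delta_{jk}$, and $|0\rangle$ the vacuum. For $\bm r\in\mathbb R^n$ the canonical probe is $|\psi_{\bm r}\rangle=\hat S(\bm r)|0\rangle$ with $\hat S(\bm r)=\prod_{j=1}^n \exp\!\big[\tfrac12 r_j(\hat a_j^2-\hat a_j^{\dagger 2})\big]$. Passive generators ($n^2$ in total, denoted $\hat g_\mu$): $\hat g_j^{\mathrm{rot}}=\hat a_j^\dagger\hat a_j$ ($1\le j\le n$); $\hat g_{jk}^{\mathrm{bsX}}=\hat a_j^\dagger\hat a_k+\hat a_k^\dagger\hat a_j$ and $\hat g_{jk}^{\mathrm{bsY}}=-i(\hat a_j^\dagger\hat a_k-\hat a_k^\dagger\hat a_j)$ ($1\le j<k\le n$). With expectation values in $|\psi_{\bm r}\rangle$ and $\Delta\hat g_\mu=\hat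 g_\mu-\langle\hat g_\mu\rangle$: the Fisher matrix is $F_{\mu\nu}=2\langle\{\Delta\hat g_\mu,\Delta\hat g_\nu\}\rangle$, the mean-commutator matrix is $\mathcal C_{\mu\nu}=\frac1{2i}\langle[\hat g_\mu,\hat g_\nu]\rangle$, and the tangent Gram matrix is $Q_{\mu\nu}=\langle\psi_{\bm r}|\Delta\hat g_\mu\,\Delta\hat g_\nu|\psi_{\bm r}\rangle=F_{\mu\nu}/4+i\,\mathcal C_{\mu\nu}$. $F_{jk}^{\mathrm{bsX}},F_{jk}^{\mathrm{bsY}}$ are the diagonal Fisher entries of the corresponding generators. Incompatibility measure: for a submodel with positive definite Fisher matrix $\bm F$ and mean-commutator matrix $\bm{\mathcal C}$, $R=\lVert i\bm F^{-1/2}\bm D\bm F^{-1/2}\rVert_{\mathrm{op}}$ with $\bm D=4\bm{\mathcal C}$ (operator norm). The spectrum $\bm r$ is regular if $2r_j\ne0$ for all $j$ and $r_j\pm r_k\ne0$ for all $j<k$. A real passive tangent subspace is a real linear subspace $V\subseteq\mathbb R^{n^2}$ of parameter directions, and it is compatible if $\bm u^{\mathrm T}\bm{\mathcal C}\,\bm v=0$ for all $\bm u,\bm v\in V$, where $\bm{\mathcal C}$ is the full $n^2\times n^2$ matrix. *)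

theory Defs
  imports "HOL-Analysis.Analysis"
begin

section \<open>Fock space\<close>

text \<open>Vectors are given by their amplitudes in the occupation-number basis: \<open>\<psi> m\<close> is the coefficient of
  the number state with \<open>m j\<close> quanta in mode \<open>j\<close>. The modes are the elements of a finite linearly
  ordered type \<open>'n\<close>, so that the number of modes is \<open>CARD('n)\<close>. The Hilbert space is \<open>fock_space\<close>;
  the unbounded operators below act on all amplitude families, and \<open>fock_inner\<close>, \<open>fock_norm\<close> are
  meaningful only on \<open>fock_space\<close> (\<open>infsum\<close> is 0 for families that are not summable).\<close>

type_synonym 'n amplitudes = "('n \<Rightarrow> nat) \<Rightarrow> complex"
type_synonym 'n operator = "'n amplitudes \<Rightarrow> 'n amplitudes"

definition fock_space :: "'n amplitudes set" where
  "fock_space = {\<psi>. (\<lambda>m. (cmod (\<psi> m))\<^sup>2) summable_on UNIV}"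

definition fock_inner :: "'n amplitudes \<Rightarrow> 'n amplitudes \<Rightarrow> complex" where
  "fock_inner \<phi> \<psi> = (\<Sum>\<^sub>\<infinity>m. cnj (\<phi> m) * \<psi> m)"

definition fock_norm :: "'n amplitudes \<Rightarrow> real" where
  "fock_norm \<psi> = sqrt (\<Sum>\<^sub>\<infinity>m. (cmod (\<psi> m))\<^sup>2)"

definition vacuum :: "'n amplitudes" where
  "vacuum m = (if m = (\<lambda>_. 0) then 1 else 0)"

definition annihilate :: "'n \<Rightarrow> 'n operator" where
  "annihilate j \<psi> m = complex_of_real (sqrt (real (m j) + 1)) * \<psi> (m(j := m j + 1))"

text \<open>For \<open>m j = 0\<close> the prefactor vanishes, so the truncated subtraction is harmless.\<close>

definition create :: "'n \<Rightarrow> 'n operator" where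
  "create j \<psi> m = complex_of_real (sqrt (real (m j))) * \<psi> (m(j := m j - 1))"

definition commutator :: "'n operator \<Rightarrow> 'n operator \<Rightarrow> 'n operator" where
  "commutator A B \<psi> m = A (B \<psi>) m - B (A \<psi>) m"

definition anticommutator :: "'n operator \<Rightarrow> 'n operator \<Rightarrow> 'n operator" where
  "anticommutator A B \<psi> m = A (B \<psi>) m + B (A \<psi>) m"

lemma canonical_commutation:
  "commutator (annihilate j) (create k) \<psi> m = (if j = k then \<psi> m else 0)"
proof (cases "j = k")
  case True
  have sq: "complex_of_real (sqrt x) * complex_of_real (sqrt x) = complex_of_real x" if "x \<ge> 0" for x
    using that by (simp flip: of_real_mult)
  show ?thesis
  proof (cases "m k")
    case 0
    then show ?thesis
      using True by (simp add: commutator_def annihilate_def create_def flip: fun_upd_def)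
        (metis fun_upd_triv)
  next
    case (Suc l)
    have m: "m(k := Suc l) = m" using Suc by (metis fun_upd_triv)
    have "commutator (annihilate j) (create k) \<psi> m
        = (complex_of_real (sqrt (real l + 2)) * complex_of_real (sqrt (real l + 2))
          - complex_of_real (sqrt (real l + 1)) * complex_of_real (sqrt (real l + 1))) * \<psi> m"
      using True Suc m
      by (simp add: commutator_def annihilate_def create_def algebra_simps)
    then show ?thesis using True by (simp add: sq)
  qed
next
  case False
  then show ?thesis
    by (simp add: commutator_def annihilate_def create_def fun_upd_twist)
qed


section \<open>Squeezed vacuum\<close>

text \<open>\<open>orbit A u\<close>: the curve \<open>u\<close> solves \<open>u' = A u\<close> in the Hilbert space, for all times. The two
  membership conditions place \<open>u t\<close> in the domain \<open>{\<psi> \<in> fock_space. A \<psi> \<in> fock_space}\<close>; for the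
  quadratic generators below this is the domain of the skew-adjoint closure of \<open>A\<close> on the vectors of
  finite particle number.\<close>

definition orbit :: "'n operator \<Rightarrow> (real \<Rightarrow> 'n amplitudes) \<Rightarrow> bool" where
  "orbit A u \<longleftrightarrow>
     (\<forall>t. u t \<in> fock_space \<and> A (u t) \<in> fock_space \<and>
        ((\<lambda>h. fock_norm (\<lambda>m. (u (t + h) m - u t m) / complex_of_real h - A (u t) m)) \<longlongrightarrow> 0) (at 0))"

text \<open>The exponential of an unbounded skew-adjoint operator, on vectors of its domain:
  \<open>exp (t A) \<psi>\<close> is the unique orbit through \<open>\<psi>\<close>. (The power series applied to the vacuum converges
  only for small squeezing.)\<close>

definition op_exp :: "'n operator \<Rightarrow> 'n operator" where
  "op_exp A \<psi> = (THE \<phi>. \<exists>u. orbit A u \<and> u 0 = \<psi> \<and> u 1 = \<phi>)"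

definition squeeze_generator :: "real \<Rightarrow> 'n \<Rightarrow> 'n operator" where
  "squeeze_generator s j \<psi> m =
     complex_of_real (s / 2) * (annihilate j (annihilate j \<psi>) m - create j (create j \<psi>) m)"

definition squeeze :: "real^'n::{finite,linorder} \<Rightarrow> 'n operator" where
  "squeeze r \<psi> = foldr (\<lambda>j. op_exp (squeeze_generator (r $ j) j)) (sorted_list_of_set UNIV) \<psi>"

definition probe :: "real^'n::{finite,linorder} \<Rightarrow> 'n amplitudes" where
  "probe r = squeeze r vacuum"


section \<open>Passive generators\<close>

definition rot :: "'n \<Rightarrow> 'n operator" where
  "rot j \<psi> = create j (annihilate j \<psi>)"

definition bsX :: "'n \<Rightarrow> 'n \<Rightarrow> 'n operator" where
  "bsX j k \<psi> m = create j (annihilate k \<psi>) m + create k (annihilate j \<psi>) m"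

definition bsY :: "'n \<Rightarrow> 'n \<Rightarrow> 'n operator" where
  "bsY j k \<psi> m = - \<i> * (create j (annihilate k \<psi>) m - create k (annihilate j \<psi>) m)"

text \<open>The generators are indexed by pairs of modes: \<open>(j, j)\<close> is the rotation of mode \<open>j\<close> and, for
  \<open>j < k\<close>, \<open>(j, k)\<close> and \<open>(k, j)\<close> are the X and Y beam splitters of the modes \<open>j\<close>, \<open>k\<close>. Each
  generator occurs exactly once, and the parameter space is \<open>real^('n \<times> 'n)\<close>.\<close>

fun generator :: "'n::linorder \<times> 'n \<Rightarrow> 'n operator" where
  "generator (j, k) = (if j = k then rot j else if j < k then bsX j k else bsY k j)"

definition mean :: "real^'n::{finite,linorder} \<Rightarrow> 'n operator \<Rightarrow> complex" where
  "mean r A = fock_inner (probe r) (A (probe r))"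

definition centred :: "real^'n::{finite,linorder} \<Rightarrow> 'n operator \<Rightarrow> 'n operator" where
  "centred r A \<psi> m = A \<psi> m - mean r A * \<psi> m"

text \<open>The anticommutator and \<open>1/(2\<i>)\<close> times the commutator of symmetric operators have real
  means, so in the next two definitions \<open>Re\<close> only changes the type.\<close>

definition fisher :: "real^'n::{finite,linorder} \<Rightarrow> real^('n \<times> 'n)^('n \<times> 'n)" where
  "fisher r = (\<chi> \<mu> \<nu>. Re (2 * mean r
     (anticommutator (centred r (generator \<mu>)) (centred r (generator \<nu>)))))"

definition mean_commutator :: "real^'n::{finite,linorder} \<Rightarrow> real^('n \<times> 'n)^('n \<times> 'n)" where
  "mean_commutator r = (\<chi> \<mu> \<nu>. Re (1 / (2 * \<i>) * mean r (commutator (generator \<mu>) (generator \<nu>))))"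

definition gram :: "real^'n::{finite,linorder} \<Rightarrow> complex^('n \<times> 'n)^('n \<times> 'n)" where
  "gram r = (\<chi> \<mu> \<nu>. mean r (\<lambda>\<psi>. centred r (generator \<mu>) (centred r (generator \<nu>) \<psi>)))"


section \<open>Submodels and incompatibility\<close>

definition submodel :: "('k::finite \<Rightarrow> 'i::finite) \<Rightarrow> 'a^'i^'i \<Rightarrow> 'a^'k^'k" where
  "submodel f M = (\<chi> a b. M $ f a $ f b)"

definition bs_pair :: "'n \<Rightarrow> 'n \<Rightarrow> 2 \<Rightarrow> 'n \<times> 'n" where
  "bs_pair j k a = (if a = 1 then (j, k) else (k, j))"

definition pos_def :: "real^'k^'k \<Rightarrow> bool" where
  "pos_def M \<longleftrightarrow> transpose M = M \<and> (\<forall>x. x \<noteq> 0 \<longrightarrow> 0 < x \<bullet> (M *v x))"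

text \<open>\<open>F\<^sup>-\<^sup>1\<^sup>/\<^sup>2\<close> for positive definite \<open>F\<close>.\<close>

definition inv_sqrt :: "real^'k^'k \<Rightarrow> real^'k^'k" where
  "inv_sqrt F = (THE S. pos_def S \<and> S ** S = matrix_inv F)"

definition incompatibility :: "real^'k^'k \<Rightarrow> real^'k^'k \<Rightarrow> real" where
  "incompatibility F C =
     (let M = inv_sqrt F ** (4 *\<^sub>R C) ** inv_sqrt F
      in onorm (\<lambda>v :: complex^'k. (\<chi> a b. \<i> * complex_of_real (M $ a $ b)) *v v))"

definition regular :: "real^'n::{finite,linorder} \<Rightarrow> bool" where
  "regular r \<longleftrightarrow> (\<forall>j. 2 * r $ j \<noteq> 0) \<and> (\<forall>j k. j < k \<longrightarrow> r $ j + r $ k \<noteq> 0 \<and> r $ j - r $ k \<noteq> 0)"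

definition compatible :: "real^'n::{finite,linorder} \<Rightarrow> (real^('n \<times> 'n)) set \<Rightarrow> bool" where
  "compatible r V \<longleftrightarrow> (\<forall>u\<in>V. \<forall>v\<in>V. u \<bullet> (mean_commutator r *v v) = 0)"

end

theory Submission
  imports Defs
begin

text \<open>On the squeezed vacuum \<open>\<psi>\<close> each \<open>a\<^sub>j\<close> acts as \<open>- tanh r\<^sub>j a\<^sub>j\<^sup>\<dagger>\<close>. Hence both beam splitters of a pair \<open>j\<close>, \<open>k\<close> send \<open>\<psi>\<close>
  to multiples of the single vector \<open>a\<^sub>j\<^sup>\<dagger> a\<^sub>k\<^sup>\<dagger> \<psi>\<close>, with a real factor for X and an imaginary one for Y; this gives
  rank one and \<open>R = 1\<close>. By parity of the occupation numbers the vectors of different pairs are orthogonal, so the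
  mean commutator is a direct sum of \<open>n(n-1)/2\<close> antisymmetric \<open>2\<times>2\<close> blocks, nonzero for regular \<open>r\<close>, and of
  \<open>n\<close> zeros for the rotations. Its maximal isotropic subspaces have dimension \<open>n + n(n-1)/2\<close>.

  The product of squeezed vacua is identified with the probe by solving \<open>u' = A u\<close> explicitly; uniqueness of
  the solution holds because \<open>A\<close> is skew on its whole domain, so the norm of the difference of two orbits is constant.\<close>

section \<open>Square-summable and exponentially decaying amplitudes\<close>

text \<open>The obstacle is analytic: \<open>op_exp\<close> refers to a norm-differentiable curve in
  the maximal domain of an unbounded operator. Differentiating the amplitudes of the explicit
  product state one by one is easy, but the difference quotient has to converge in
  \<open>fock_norm\<close>. Geometric decay in the number of quanta provides this: it survives the
  ladder operators, with constants uniform along the curve, and it makes the later sums over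
  generators converge absolutely. A competing orbit, on the other hand, offers nothing beyond
  square-summability of the state and of its image. Skewness must then come from the coefficients of
  the generator, whose linear growth is just slow enough for the divergence of the harmonic series
  to give a contradiction. The value \<open>R = 1\<close> does not depend on the squeezing: with
  real factors \<open>a\<close> for X, \<open>b\<close> for Y and \<open>N\<close> the squared norm
  of the common vector, the Fisher entries are \<open>4 a\<^sup>2 N\<close> and
  \<open>4 b\<^sup>2 N\<close> and the commutator entry is \<open>a b N\<close> up to sign, so the
  normalisation cancels everything.\<close>

lemma infinite_sum_Cauchy_Schwarz:
  fixes f g :: "'a \<Rightarrow> complex"
  assumes f: "(\<lambda>x. (cmod (f x))\<^sup>2) summable_on A" and g: "(\<lambda>x. (cmod (g x))\<^sup>2) summable_on A"
  shows "(\<lambda>x. cnj (f x) * g x) summable_on A"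
    and "cmod (\<Sum>\<^sub>\<infinity>x\<in>A. cnj (f x) * g x)
           \<le> sqrt (\<Sum>\<^sub>\<infinity>x\<in>A. (cmod (f x))\<^sup>2) * sqrt (\<Sum>\<^sub>\<infinity>x\<in>A. (cmod (g x))\<^sup>2)"
proof -
  have "(\<lambda>x. (cmod (f x))\<^sup>2 + (cmod (g x))\<^sup>2) summable_on A"
    using f g by (rule summable_on_add)
  then have abs: "(\<lambda>x. cmod (cnj (f x) * g x)) summable_on A"
  proof (rule summable_on_comparison_test)
    fix x
    have "2 * (cmod (f x) * cmod (g x)) \<le> (cmod (f x))\<^sup>2 + (cmod (g x))\<^sup>2"
      using sum_squares_bound[of "cmod (f x)" "cmod (g x)"] by simp
    moreover have "0 \<le> cmod (f x) * cmod (g x)" by simp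
    ultimately show "cmod (cnj (f x) * g x) \<le> (cmod (f x))\<^sup>2 + (cmod (g x))\<^sup>2"
      unfolding norm_mult complex_mod_cnj by linarith
  qed simp
  show "(\<lambda>x. cnj (f x) * g x) summable_on A"
    using abs by (rule abs_summable_summable)
  have "cmod (\<Sum>\<^sub>\<infinity>x\<in>A. cnj (f x) * g x) \<le> (\<Sum>\<^sub>\<infinity>x\<in>A. cmod (cnj (f x) * g x))"
    by (rule norm_infsum_bound[OF abs])
  also have "\<dots> \<le> sqrt (\<Sum>\<^sub>\<infinity>x\<in>A. (cmod (f x))\<^sup>2) * sqrt (\<Sum>\<^sub>\<infinity>x\<in>A. (cmod (g x))\<^sup>2)"
  proof (rule infsum_le_finite_sums[OF abs])
    fix F assume F: "finite F" "F \<subseteq> A"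
    have "(\<Sum>x\<in>F. cmod (cnj (f x) * g x)) = (\<Sum>x\<in>F. \<bar>cmod (f x)\<bar> * \<bar>cmod (g x)\<bar>)"
      by (simp add: norm_mult)
    also have "\<dots> \<le> L2_set (\<lambda>x. cmod (f x)) F * L2_set (\<lambda>x. cmod (g x)) F"
      by (rule L2_set_mult_ineq)
    also have "\<dots> \<le> sqrt (\<Sum>\<^sub>\<infinity>x\<in>A. (cmod (f x))\<^sup>2) * sqrt (\<Sum>\<^sub>\<infinity>x\<in>A. (cmod (g x))\<^sup>2)"
      unfolding L2_set_def using F f g
      by (intro mult_mono real_sqrt_le_mono finite_sum_le_infsum) (auto intro: sum_nonneg infsum_nonneg)
    finally show "(\<Sum>x\<in>F. cmod (cnj (f x) * g x))
        \<le> sqrt (\<Sum>\<^sub>\<infinity>x\<in>A. (cmod (f x))\<^sup>2) * sqrt (\<Sum>\<^sub>\<infinity>x\<in>A. (cmod (g x))\<^sup>2)" .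
  qed
  finally show "cmod (\<Sum>\<^sub>\<infinity>x\<in>A. cnj (f x) * g x)
      \<le> sqrt (\<Sum>\<^sub>\<infinity>x\<in>A. (cmod (f x))\<^sup>2) * sqrt (\<Sum>\<^sub>\<infinity>x\<in>A. (cmod (g x))\<^sup>2)" .
qed

lemma cmod_add_square_le: "(cmod (z + w))\<^sup>2 \<le> 2 * (cmod z)\<^sup>2 + 2 * (cmod w)\<^sup>2"
proof -
  have "(cmod (z + w))\<^sup>2 \<le> (cmod z + cmod w)\<^sup>2"
    by (intro power_mono norm_triangle_ineq) simp
  also have "\<dots> \<le> 2 * (cmod z)\<^sup>2 + 2 * (cmod w)\<^sup>2"
    using sum_squares_bound[of "cmod z" "cmod w"] by (simp add: power2_sum)
  finally show ?thesis .
qed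

lemma square_summable_add:
  fixes f g :: "'a \<Rightarrow> complex"
  assumes "(\<lambda>x. (cmod (f x))\<^sup>2) summable_on A" "(\<lambda>x. (cmod (g x))\<^sup>2) summable_on A"
  shows "(\<lambda>x. (cmod (f x + g x))\<^sup>2) summable_on A"
    and "(\<Sum>\<^sub>\<infinity>x\<in>A. (cmod (f x + g x))\<^sup>2)
           \<le> 2 * (\<Sum>\<^sub>\<infinity>x\<in>A. (cmod (f x))\<^sup>2) + 2 * (\<Sum>\<^sub>\<infinity>x\<in>A. (cmod (g x))\<^sup>2)"
proof -
  have s: "(\<lambda>x. 2 * (cmod (f x))\<^sup>2) summable_on A" "(\<lambda>x. 2 * (cmod (g x))\<^sup>2) summable_on A"
    using assms by (auto intro: summable_on_cmult_right)
  show 1: "(\<lambda>x. (cmod (f x + g x))\<^sup>2) summable_on A"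
    by (rule summable_on_comparison_test[OF summable_on_add[OF s]]) (auto intro: cmod_add_square_le)
  have "(\<Sum>\<^sub>\<infinity>x\<in>A. (cmod (f x + g x))\<^sup>2) \<le> (\<Sum>\<^sub>\<infinity>x\<in>A. 2 * (cmod (f x))\<^sup>2 + 2 * (cmod (g x))\<^sup>2)"
    by (rule infsum_mono[OF 1 summable_on_add[OF s]]) (rule cmod_add_square_le)
  also have "\<dots> = 2 * (\<Sum>\<^sub>\<infinity>x\<in>A. (cmod (f x))\<^sup>2) + 2 * (\<Sum>\<^sub>\<infinity>x\<in>A. (cmod (g x))\<^sup>2)"
    by (simp add: infsum_add[OF s] infsum_cmult_right')
  finally show "(\<Sum>\<^sub>\<infinity>x\<in>A. (cmod (f x + g x))\<^sup>2)
      \<le> 2 * (\<Sum>\<^sub>\<infinity>x\<in>A. (cmod (f x))\<^sup>2) + 2 * (\<Sum>\<^sub>\<infinity>x\<in>A. (cmod (g x))\<^sup>2)" .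
qed

lemma square_summable_scale:
  fixes f :: "'a \<Rightarrow> complex"
  assumes "(\<lambda>x. (cmod (f x))\<^sup>2) summable_on A"
  shows "(\<lambda>x. (cmod (c * f x))\<^sup>2) summable_on A"
  using summable_on_cmult_right[OF assms, of "(cmod c)\<^sup>2"] by (simp add: norm_mult power_mult_distrib)

lemma square_summable_diff:
  fixes f g :: "'a \<Rightarrow> complex"
  assumes "(\<lambda>x. (cmod (f x))\<^sup>2) summable_on A" "(\<lambda>x. (cmod (g x))\<^sup>2) summable_on A"
  shows "(\<lambda>x. (cmod (f x - g x))\<^sup>2) summable_on A"
    and "(\<Sum>\<^sub>\<infinity>x\<in>A. (cmod (f x - g x))\<^sup>2)
           \<le> 2 * (\<Sum>\<^sub>\<infinity>x\<in>A. (cmod (f x))\<^sup>2) + 2 * (\<Sum>\<^sub>\<infinity>x\<in>A. (cmod (g x))\<^sup>2)"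
  using square_summable_add[of f A "\<lambda>x. - g x"] assms by auto


section \<open>Geometric decay in the total number of quanta\<close>

definition quanta :: "('n::finite \<Rightarrow> nat) \<Rightarrow> nat" where
  "quanta m = (\<Sum>i\<in>UNIV. m i)"

lemma quanta_upd: "quanta (m(j := l)) + m j = quanta m + l" for m :: "'n::finite \<Rightarrow> nat"
proof -
  have "quanta (m(j := l)) = l + (\<Sum>i\<in>UNIV - {j}. m i)"
    by (simp add: quanta_def sum.remove[of UNIV j])
  moreover have "quanta m = m j + (\<Sum>i\<in>UNIV - {j}. m i)"
    by (simp add: quanta_def sum.remove[of UNIV j])
  ultimately show ?thesis by simp
qed

text \<open>Over a box of occupation numbers the sum factors into one geometric sum per mode, each
  at most \<open>1 / (1 - \<rho>)\<close>, and every finite set of indices lies in such a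
  box.\<close>

lemma summable_geometric_quanta:
  fixes \<rho> :: real
  assumes "0 < \<rho>" "\<rho> < 1"
  shows "(\<lambda>m :: 'n::finite \<Rightarrow> nat. \<rho> ^ quanta m) summable_on UNIV"
proof (rule nonneg_bounded_partial_sums_imp_summable_on)
  show "\<forall>\<^sub>F X in finite_subsets_at_top UNIV. (\<Sum>m::'n\<Rightarrow>nat\<in>X. \<rho> ^ quanta m) \<le> (1 / (1 - \<rho>)) ^ CARD('n)"
  proof (rule eventually_finite_subsets_at_top_weakI)
    fix X :: "('n \<Rightarrow> nat) set" assume X: "finite X"
    define N where "N = Max (insert 0 (quanta ` X))"
    have "m i \<le> N" if "m \<in> X" for m i
    proof -
      have "m i \<le> quanta m" unfolding quanta_def by (intro member_le_sum) auto
      also have "\<dots> \<le> N" unfolding N_def using X that by (intro Max_ge) auto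
      finally show ?thesis .
    qed
    then have "X \<subseteq> PiE UNIV (\<lambda>_. {..N})" by auto
    then have "(\<Sum>m\<in>X. \<rho> ^ quanta m) \<le> (\<Sum>m\<in>PiE UNIV (\<lambda>_::'n. {..N}). \<rho> ^ quanta m)"
      using assms by (intro sum_mono2 finite_PiE) auto
    also have "\<dots> = (\<Prod>i\<in>(UNIV::'n set). \<Sum>n\<le>N. \<rho> ^ n)"
      by (subst prod_sum_PiE) (auto simp: quanta_def power_sum)
    also have "\<dots> \<le> (\<Prod>i\<in>(UNIV::'n set). 1 / (1 - \<rho>))"
    proof (rule prod_mono, intro conjI)
      show "(\<Sum>n\<le>N. \<rho> ^ n) \<le> 1 / (1 - \<rho>)"
        using assms sum_le_suminf[OF summable_geometric, of \<rho> "{..N}"] by (simp add: suminf_geometric)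
    qed (use assms in \<open>simp add: sum_nonneg\<close>)
    finally show "(\<Sum>m\<in>X. \<rho> ^ quanta m) \<le> (1 / (1 - \<rho>)) ^ CARD('n)" by simp
  qed
qed (use assms in auto)

text \<open>Square-summability is not preserved by the ladder operators, whereas this bound is,
  after a slight increase of the rate. Constant and rate are explicit because the orbit construction
  needs estimates uniform over a family of states.\<close>

definition decay :: "real \<Rightarrow> real \<Rightarrow> 'n::finite amplitudes \<Rightarrow> bool" where
  "decay K \<rho> \<psi> \<longleftrightarrow> (\<forall>m. cmod (\<psi> m) \<le> K * \<rho> ^ quanta m)"

definition decaying :: "'n::finite amplitudes \<Rightarrow> bool" where
  "decaying \<psi> \<longleftrightarrow> (\<exists>K \<rho>. 0 < \<rho> \<and> \<rho> < 1 \<and> decay K \<rho> \<psi>)"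

lemma decay_nonneg:
  assumes "decay K \<rho> \<psi>" shows "0 \<le> K"
proof -
  have "cmod (\<psi> (\<lambda>_. 0)) \<le> K * \<rho> ^ quanta (\<lambda>_::'a. 0)" using assms unfolding decay_def by blast
  then have "cmod (\<psi> (\<lambda>_. 0)) \<le> K" by (simp add: quanta_def)
  then show ?thesis using norm_ge_zero[of "\<psi> (\<lambda>_. 0)"] by linarith
qed

lemma decay_mono:
  assumes "decay K \<rho> \<psi>" "K \<le> K'" "0 < \<rho>" "\<rho> \<le> \<rho>'"
  shows "decay K' \<rho>' \<psi>"
  unfolding decay_def
proof
  fix m
  have "cmod (\<psi> m) \<le> K * \<rho> ^ quanta m" using assms by (simp add: decay_def)
  also have "\<dots> \<le> K' * \<rho>' ^ quanta m"
    using assms decay_nonneg[OF assms(1)] by (intro mult_mono power_mono) auto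
  finally show "cmod (\<psi> m) \<le> K' * \<rho>' ^ quanta m" .
qed

text \<open>With \<open>x = \<rho> / \<sigma> < 1\<close> the sequence \<open>(n + 1) x^n\<close>
  tends to 0, so it is bounded: a linear factor costs only a larger rate.\<close>

lemma linear_times_geometric_le:
  fixes \<rho> \<sigma> :: real
  assumes "0 < \<rho>" "\<rho> < \<sigma>"
  obtains B where "0 \<le> B" "\<And>n. (real n + 1) * \<rho> ^ n \<le> B * \<sigma> ^ n"
proof -
  define x where "x = \<rho> / \<sigma>"
  have x: "0 < x" "x < 1" using assms by (auto simp: x_def)
  have "(\<lambda>n. real n * x ^ n + x ^ n) \<longlonglongrightarrow> 0 + 0"
    using x by (intro tendsto_add powser_times_n_limit_0 LIMSEQ_power_zero) auto
  then have "Bseq (\<lambda>n. real n * x ^ n + x ^ n)" by (intro convergent_imp_Bseq convergentI)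
  then obtain B where B: "\<And>n. norm (real n * x ^ n + x ^ n) \<le> B" unfolding Bseq_def by auto
  have "(real n + 1) * \<rho> ^ n \<le> B * \<sigma> ^ n" for n
  proof -
    have "\<rho> ^ n = x ^ n * \<sigma> ^ n" using assms by (simp add: x_def power_divide)
    then have "(real n + 1) * \<rho> ^ n = (real n * x ^ n + x ^ n) * \<sigma> ^ n" by (simp add: algebra_simps)
    also have "\<dots> \<le> B * \<sigma> ^ n" using B[of n] assms by (intro mult_right_mono) auto
    finally show ?thesis .
  qed
  moreover have "0 \<le> B" using B[of 0] norm_ge_zero order_trans by blast
  ultimately show thesis using that by blast
qed

text \<open>The square root in front of the amplitude is at most linear in the number of quanta and
  is absorbed by the larger rate. \<open>L\<close> is fixed before the mode and the state, which
  makes the estimate uniform.\<close>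

lemma decay_ladder:
  assumes "0 < \<rho>" "\<rho> < \<sigma>" "\<sigma> \<le> 1" "0 \<le> K"
  obtains L where "\<And>j (\<psi>::'n::finite amplitudes). decay K \<rho> \<psi> \<Longrightarrow>
    decay L \<sigma> (annihilate j \<psi>) \<and> decay L \<sigma> (create j \<psi>)"
proof -
  obtain B where B: "0 \<le> B" "\<And>n. (real n + 1) * \<rho> ^ n \<le> B * \<sigma> ^ n"
    using linear_times_geometric_le[OF assms(1,2)] by blast
  have sq: "sqrt (real a) \<le> real b + 1" if "a \<le> b + 1" for a b :: nat
  proof -
    have "real a \<le> (real a)\<^sup>2"
      by (cases a) (auto simp: power2_eq_square algebra_simps)
    then have "sqrt (real a) \<le> real a" by (intro real_le_lsqrt) auto
    then show ?thesis using that by linarith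
  qed
  \<comment> \<open>Covers both operators at once: the amplitude is read at an index
    \<open>m'\<close> with at most one quantum fewer than \<open>m\<close>, and that quantum costs
    the factor \<open>1 / \<rho>\<close>.\<close>
  have key: "cmod (complex_of_real (sqrt (real a)) * \<psi> m') \<le> K * B / \<rho> * \<sigma> ^ quanta m"
    if d: "decay K \<rho> \<psi>" and m: "quanta m \<le> quanta m' + 1" and a: "a \<le> quanta m + 1"
    for \<psi> :: "'n amplitudes" and a m m'
  proof -
    have "\<rho> ^ quanta m' * \<rho> \<le> \<rho> ^ quanta m"
      using power_decreasing[OF m, of \<rho>] assms by (simp add: mult.commute)
    then have r: "\<rho> ^ quanta m' \<le> \<rho> ^ quanta m / \<rho>" using assms by (simp add: field_simps)
    have "cmod (complex_of_real (sqrt (real a)) * \<psi> m') \<le> (real (quanta m) + 1) * (K * (\<rho> ^ quanta m / \<rho>))"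
      unfolding norm_mult
    proof (rule mult_mono)
      have "cmod (\<psi> m') \<le> K * \<rho> ^ quanta m'" using d by (simp add: decay_def)
      also have "\<dots> \<le> K * (\<rho> ^ quanta m / \<rho>)" using r assms(4) by (rule mult_left_mono)
      finally show "cmod (\<psi> m') \<le> K * (\<rho> ^ quanta m / \<rho>)" .
    qed (use sq[OF a] in auto)
    also have "\<dots> = K / \<rho> * ((real (quanta m) + 1) * \<rho> ^ quanta m)" by simp
    also have "\<dots> \<le> K / \<rho> * (B * \<sigma> ^ quanta m)"
      using assms B(2) by (intro mult_left_mono) auto
    finally show ?thesis by simp
  qed
  have L: "decay (K * B / \<rho>) \<sigma> (annihilate j \<psi>) \<and> decay (K * B / \<rho>) \<sigma> (create j \<psi>)"
    if d: "decay K \<rho> \<psi>" for j and \<psi> :: "'n amplitudes"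
  proof
    have le: "m j \<le> quanta m" for m
      unfolding quanta_def by (intro member_le_sum) auto
    show "decay (K * B / \<rho>) \<sigma> (annihilate j \<psi>)"
      unfolding decay_def annihilate_def
    proof
      fix m
      have "quanta m \<le> quanta (m(j := m j + 1)) + 1"
        using quanta_upd[of m j "m j + 1"] by linarith
      then show "cmod (complex_of_real (sqrt (real (m j) + 1)) * \<psi> (m(j := m j + 1))) \<le> K * B / \<rho> * \<sigma> ^ quanta m"
        using key[OF d, of m "m(j := m j + 1)" "m j + 1"] le[of m] by (simp add: add.commute)
    qed
    show "decay (K * B / \<rho>) \<sigma> (create j \<psi>)"
      unfolding decay_def create_def
    proof
      fix m
      have "quanta m \<le> quanta (m(j := m j - 1)) + 1"
        using quanta_upd[of m j "m j - 1"] by linarith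
      then show "cmod (complex_of_real (sqrt (real (m j))) * \<psi> (m(j := m j - 1))) \<le> K * B / \<rho> * \<sigma> ^ quanta m"
        using le[of m] by (intro key[OF d]) auto
    qed
  qed
  then show thesis using that by blast
qed

lemma decay_scale:
  assumes "decay K \<rho> \<psi>" shows "decay (cmod c * K) \<rho> (\<lambda>m. c * \<psi> m)"
  using assms by (simp add: decay_def norm_mult mult.assoc mult_left_mono)

lemma decay_add:
  assumes "decay K \<rho> \<phi>" "decay L \<rho> \<psi>" shows "decay (K + L) \<rho> (\<lambda>m. \<phi> m + \<psi> m)"
  using assms unfolding decay_def
  by (auto simp: distrib_right intro: norm_triangle_le add_mono)

lemma decay_diff:
  assumes "decay K \<rho> \<phi>" "decay L \<rho> \<psi>" shows "decay (K + L) \<rho> (\<lambda>m. \<phi> m - \<psi> m)"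
  using decay_add[OF assms(1) decay_scale[OF assms(2), of "- 1"]] by simp

lemma decay_squeeze_generator:
  assumes "0 < \<rho>" "\<rho> < 1" "0 \<le> K"
  obtains L \<sigma> where "0 < \<sigma>" "\<sigma> < 1"
    "\<And>\<psi>::'n::finite amplitudes. decay K \<rho> \<psi> \<Longrightarrow> decay L \<sigma> (squeeze_generator s j \<psi>)"
proof -
  \<comment> \<open>The generator is quadratic, so the rate is enlarged twice, once for each ladder
    operator.\<close>
  define \<sigma>1 \<sigma> where "\<sigma>1 = (\<rho> + 1) / 2" and "\<sigma> = (\<sigma>1 + 1) / 2"
  have o: "0 < \<sigma>1" "\<rho> < \<sigma>1" "\<sigma>1 < \<sigma>" "\<sigma> < 1" "0 < \<sigma>"
    using assms by (auto simp: \<sigma>1_def \<sigma>_def field_simps)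
  obtain L1 where L1: "\<And>j (\<psi>::'n amplitudes). decay K \<rho> \<psi> \<Longrightarrow>
    decay L1 \<sigma>1 (annihilate j \<psi>) \<and> decay L1 \<sigma>1 (create j \<psi>)"
    using decay_ladder[OF assms(1) o(2) _ assms(3)] o by (auto simp: less_imp_le)
  show thesis
  proof (cases "0 \<le> L1")
    case True
    obtain L2 where L2: "\<And>j (\<psi>::'n amplitudes). decay L1 \<sigma>1 \<psi> \<Longrightarrow>
      decay L2 \<sigma> (annihilate j \<psi>) \<and> decay L2 \<sigma> (create j \<psi>)"
      using decay_ladder[OF o(1,3) _ True] o by (auto simp: less_imp_le)
    have "decay (cmod (complex_of_real (s / 2)) * (L2 + L2)) \<sigma> (squeeze_generator s j \<psi>)"
      if "decay K \<rho> \<psi>" for \<psi> :: "'n amplitudes"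
    proof -
      have "decay (cmod (complex_of_real (s / 2)) * (L2 + L2)) \<sigma> (\<lambda>m. complex_of_real (s / 2) *
        (annihilate j (annihilate j \<psi>) m - create j (create j \<psi>) m))"
        using L1[OF that, of j, THEN conjunct1, THEN L2, of j, THEN conjunct1]
          L1[OF that, of j, THEN conjunct2, THEN L2, of j, THEN conjunct2]
        by (intro decay_scale decay_diff)
      then show ?thesis by (simp add: squeeze_generator_def[abs_def])
    qed
    then show thesis using that o by blast
  next
    \<comment> \<open>A negative \<open>L1\<close> contradicts \<open>decay_nonneg\<close>, so no
      state satisfies the premise and any constants will do.\<close>
    case False
    then have "\<not> decay K \<rho> \<psi>" for \<psi> :: "'n amplitudes" using L1 decay_nonneg by blast
    then show thesis using that assms by blast
  qed
qed

lemma decaying_scale: "decaying \<psi> \<Longrightarrow> decaying (\<lambda>m. c * \<psi> m)"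
  unfolding decaying_def by (elim exE conjE) (rule exI, rule exI, intro conjI, (assumption | erule decay_scale)+)

lemma decaying_add:
  assumes "decaying \<phi>" "decaying \<psi>" shows "decaying (\<lambda>m. \<phi> m + \<psi> m)"
proof -
  obtain K \<rho> L \<sigma> where *: "0 < \<rho>" "\<rho> < 1" "decay K \<rho> \<phi>" "0 < \<sigma>" "\<sigma> < 1" "decay L \<sigma> \<psi>"
    using assms unfolding decaying_def by blast
  then have "decay K (max \<rho> \<sigma>) \<phi>" "decay L (max \<rho> \<sigma>) \<psi>" by (auto intro: decay_mono)
  from decay_add[OF this] show ?thesis unfolding decaying_def
    using * by (intro exI[of _ "K + L"] exI[of _ "max \<rho> \<sigma>"]) auto
qed

lemma decaying_ladder:
  assumes "decaying \<psi>" shows "decaying (annihilate j \<psi>)" "decaying (create j \<psi>)"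
proof -
  obtain K \<rho> where *: "0 < \<rho>" "\<rho> < 1" "decay K \<rho> \<psi>" using assms unfolding decaying_def by blast
  define \<sigma> where "\<sigma> = (\<rho> + 1) / 2"
  have o: "\<rho> < \<sigma>" "\<sigma> < 1" "0 < \<sigma>" using * by (auto simp: \<sigma>_def)
  obtain L where "decay L \<sigma> (annihilate j \<psi>) \<and> decay L \<sigma> (create j \<psi>)"
    using decay_ladder[OF *(1) o(1) _ decay_nonneg[OF *(3)]] o *(3) by (metis less_imp_le)
  then show "decaying (annihilate j \<psi>)" "decaying (create j \<psi>)" unfolding decaying_def using o by blast+
qed

lemma decay_square_summable:
  fixes \<psi> :: "'n::finite amplitudes"
  assumes "0 < \<rho>" "\<rho> < 1" "decay K \<rho> \<psi>"
  shows "(\<lambda>m. (cmod (\<psi> m))\<^sup>2) summable_on UNIV"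
    and "fock_norm \<psi> \<le> K * sqrt (\<Sum>\<^sub>\<infinity>m::'n\<Rightarrow>nat. (\<rho>\<^sup>2) ^ quanta m)"
proof -
  have g: "(\<lambda>m::'n\<Rightarrow>nat. (\<rho>\<^sup>2) ^ quanta m) summable_on UNIV"
    using assms by (intro summable_geometric_quanta) (auto simp: power_less_one_iff)
  have le: "(cmod (\<psi> m))\<^sup>2 \<le> K\<^sup>2 * (\<rho>\<^sup>2) ^ quanta m" for m
  proof -
    have "(cmod (\<psi> m))\<^sup>2 \<le> (K * \<rho> ^ quanta m)\<^sup>2"
      using assms(3) by (intro power_mono) (auto simp: decay_def)
    then show ?thesis by (simp add: power_mult_distrib power_mult[symmetric] mult.commute)
  qed
  show s: "(\<lambda>m. (cmod (\<psi> m))\<^sup>2) summable_on UNIV"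
    using summable_on_cmult_right[OF g, of "K\<^sup>2"]
    by (rule summable_on_comparison_test) (use le in auto)
  have "(\<Sum>\<^sub>\<infinity>m. (cmod (\<psi> m))\<^sup>2) \<le> (\<Sum>\<^sub>\<infinity>m::'n\<Rightarrow>nat. K\<^sup>2 * (\<rho>\<^sup>2) ^ quanta m)"
    using le by (intro infsum_mono s summable_on_cmult_right[OF g])
  then have "fock_norm \<psi> \<le> sqrt (K\<^sup>2 * (\<Sum>\<^sub>\<infinity>m::'n\<Rightarrow>nat. (\<rho>\<^sup>2) ^ quanta m))"
    by (simp add: fock_norm_def infsum_cmult_right')
  then show "fock_norm \<psi> \<le> K * sqrt (\<Sum>\<^sub>\<infinity>m::'n\<Rightarrow>nat. (\<rho>\<^sup>2) ^ quanta m)"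
    using decay_nonneg[OF assms(3)] by (simp add: real_sqrt_mult)
qed

lemma decaying_square_summable: "decaying \<psi> \<Longrightarrow> (\<lambda>m. (cmod (\<psi> m))\<^sup>2) summable_on UNIV"
  unfolding decaying_def using decay_square_summable(1) by blast

lemma decaying_inner_summable:
  "decaying \<phi> \<Longrightarrow> decaying \<psi> \<Longrightarrow> (\<lambda>m. cnj (\<phi> m) * \<psi> m) summable_on UNIV"
  by (intro infinite_sum_Cauchy_Schwarz(1) decaying_square_summable)


section \<open>Uniqueness of squeezing orbits\<close>

text \<open>The action on one mode with all other occupations frozen. The truncated subtractions are
  harmless, as \<open>n * (n - 1)\<close> vanishes for \<open>n < 2\<close>.\<close>

definition squeeze_generator1 :: "real \<Rightarrow> (nat \<Rightarrow> complex) \<Rightarrow> nat \<Rightarrow> complex" where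
  "squeeze_generator1 s f n = complex_of_real (s / 2) *
     (complex_of_real (sqrt (real ((n + 1) * (n + 2)))) * f (n + 2)
      - complex_of_real (sqrt (real (n * (n - 1)))) * f (n - 2))"

lemma squeeze_generator_slice:
  "squeeze_generator s j \<psi> (m(j := n)) = squeeze_generator1 s (\<lambda>l. \<psi> (m(j := l))) n"
proof -
  have "sqrt (real n + 1) * sqrt (real n + 1 + 1) = sqrt (real ((n + 1) * (n + 2)))"
    by (simp add: real_sqrt_mult[symmetric] algebra_simps)
  moreover have "sqrt (real n) * sqrt (real (n - 1)) = sqrt (real (n * (n - 1)))"
    by (simp add: real_sqrt_mult[symmetric])
  moreover have "n - 1 - 1 = n - 2" by simp
  ultimately show ?thesis
    by (simp add: squeeze_generator_def squeeze_generator1_def annihilate_def create_def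
        mult.assoc[symmetric] of_real_mult[symmetric] del: of_real_mult)
qed

text \<open>The terms linking \<open>n\<close> with \<open>n + 2\<close> occur with opposite signs
  and cancel in the real part. Since the links have length two, cutting the sum leaves two of them
  across the boundary.\<close>

lemma squeeze_generator1_partial_sum:
  "(\<Sum>n<N+2. Re (cnj (f n) * squeeze_generator1 s f n)) =
     s / 2 * (sqrt (real ((N + 1) * (N + 2))) * Re (cnj (f N) * f (N + 2))
       + sqrt (real ((N + 2) * (N + 3))) * Re (cnj (f (N + 1)) * f (N + 3)))"
proof (induction N)
  case 0
  show ?case
    by (simp add: squeeze_generator1_def numeral_2_eq_2 numeral_3_eq_3 field_simps)
next
  case (Suc N)
  have "Re (cnj (f (N + 2)) * squeeze_generator1 s f (N + 2)) =
     s / 2 * (sqrt (real ((N + 3) * (N + 4))) * Re (cnj (f (N + 2)) * f (N + 4))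
       - sqrt (real ((N + 1) * (N + 2))) * Re (cnj (f N) * f (N + 2)))"
    by (simp add: squeeze_generator1_def field_simps numeral_eq_Suc)
  with Suc.IH show ?case by (simp add: numeral_eq_Suc algebra_simps)
qed

text \<open>Carleman's argument: the boundary term of the partial sums up to \<open>N\<close> is at most \<open>N\<close> times the
  \<open>N\<close>-th term of a convergent series, so it cannot stay away from 0.\<close>

lemma squeeze_generator1_skew:
  assumes f: "(\<lambda>n. (cmod (f n))\<^sup>2) summable_on UNIV"
    and a: "(\<lambda>n. (cmod (squeeze_generator1 s f n))\<^sup>2) summable_on UNIV"
  shows "Re (\<Sum>\<^sub>\<infinity>n. cnj (f n) * squeeze_generator1 s f n) = 0"
proof (rule ccontr)
  define L where "L = Re (\<Sum>\<^sub>\<infinity>n. cnj (f n) * squeeze_generator1 s f n)"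
  assume "Re (\<Sum>\<^sub>\<infinity>n. cnj (f n) * squeeze_generator1 s f n) \<noteq> 0"
  then have L0: "L \<noteq> 0" by (simp add: L_def)
  have "((\<lambda>n. Re (cnj (f n) * squeeze_generator1 s f n)) has_sum L) UNIV"
    unfolding L_def by (intro has_sum_Re has_sum_infsum infinite_sum_Cauchy_Schwarz(1) f a)
  then have "(\<lambda>N. \<Sum>n<N. Re (cnj (f n) * squeeze_generator1 s f n)) \<longlonglongrightarrow> L"
    using has_sum_imp_sums unfolding sums_def by blast
  then have lim: "(\<lambda>N. \<bar>\<Sum>n<N+2. Re (cnj (f n) * squeeze_generator1 s f n)\<bar>) \<longlonglongrightarrow> \<bar>L\<bar>"
    by (intro tendsto_rabs LIMSEQ_ignore_initial_segment)
  \<comment> \<open>These are the four amplitudes in the two boundary links.\<close>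
  define G where "G N = (cmod (f N))\<^sup>2 + (cmod (f (N+1)))\<^sup>2 + (cmod (f (N+2)))\<^sup>2 + (cmod (f (N+3)))\<^sup>2" for N
  have sf: "summable (\<lambda>n. (cmod (f n))\<^sup>2)" by (rule summable_on_imp_summable[OF f])
  have sG: "summable G"
    unfolding G_def[abs_def] using sf summable_ignore_initial_segment[OF sf]
    by (intro summable_add) blast+
  have bound: "\<bar>\<Sum>n<N+2. Re (cnj (f n) * squeeze_generator1 s f n)\<bar> \<le> \<bar>s\<bar> / 2 * (real (N + 3) * G N)" for N
  proof -
    have re: "\<bar>Re (cnj z * w)\<bar> \<le> ((cmod z)\<^sup>2 + (cmod w)\<^sup>2)" for z w
    proof -
      have "\<bar>Re (cnj z * w)\<bar> \<le> cmod z * cmod w"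
        using abs_Re_le_cmod[of "cnj z * w"] by (simp add: norm_mult)
      also have "\<dots> \<le> (cmod z)\<^sup>2 + (cmod w)\<^sup>2"
        using sum_squares_bound[of "cmod z" "cmod w"] mult_nonneg_nonneg[OF norm_ge_zero norm_ge_zero, of z w]
        by linarith
      finally show ?thesis .
    qed
    have sq: "sqrt (real (a * b)) \<le> real (N + 3)" if "a \<le> N + 3" "b \<le> N + 3" for a b
    proof -
      have "a * b \<le> (N + 3) * (N + 3)" using that by (rule mult_le_mono)
      then have "sqrt (real (a * b)) \<le> sqrt ((real (N + 3))\<^sup>2)"
        unfolding power2_eq_square of_nat_mult[symmetric] by (intro real_sqrt_le_mono) linarith
      then show ?thesis by simp
    qed
    have t1: "\<bar>sqrt (real ((N + 1) * (N + 2))) * Re (cnj (f N) * f (N + 2))\<bar>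
        \<le> real (N + 3) * ((cmod (f N))\<^sup>2 + (cmod (f (N+2)))\<^sup>2)"
      unfolding abs_mult by (intro mult_mono re) (use sq[of "N+1" "N+2"] in auto)
    have t2: "\<bar>sqrt (real ((N + 2) * (N + 3))) * Re (cnj (f (N + 1)) * f (N + 3))\<bar>
        \<le> real (N + 3) * ((cmod (f (N+1)))\<^sup>2 + (cmod (f (N+3)))\<^sup>2)"
      unfolding abs_mult by (intro mult_mono re) (use sq[of "N+2" "N+3"] in auto)
    have "\<bar>sqrt (real ((N + 1) * (N + 2))) * Re (cnj (f N) * f (N + 2))
       + sqrt (real ((N + 2) * (N + 3))) * Re (cnj (f (N + 1)) * f (N + 3))\<bar> \<le> real (N + 3) * G N"
      using t1 t2 by (simp add: G_def algebra_simps)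
    then have "\<bar>s\<bar> / 2 * \<bar>sqrt (real ((N + 1) * (N + 2))) * Re (cnj (f N) * f (N + 2))
       + sqrt (real ((N + 2) * (N + 3))) * Re (cnj (f (N + 1)) * f (N + 3))\<bar> \<le> \<bar>s\<bar> / 2 * (real (N + 3) * G N)"
      by (rule mult_left_mono) simp
    then show ?thesis unfolding squeeze_generator1_partial_sum by (simp add: abs_mult)
  qed
  have "\<forall>\<^sub>F N in sequentially. \<bar>L\<bar> / 2 < \<bar>\<Sum>n<N+2. Re (cnj (f n) * squeeze_generator1 s f n)\<bar>"
    using lim L0 by (intro order_tendstoD(1)[OF lim]) auto
  \<comment> \<open>If the limit were nonzero, \<open>1 / (N + 3)\<close> would eventually be
    dominated by a multiple of the summable \<open>G N\<close>, and the harmonic series would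
    converge.\<close>
  then have ev: "\<forall>\<^sub>F N in sequentially. norm (inverse (real (N + 3))) \<le> \<bar>s\<bar> / \<bar>L\<bar> * G N"
  proof (rule eventually_mono)
    fix N assume "\<bar>L\<bar> / 2 < \<bar>\<Sum>n<N+2. Re (cnj (f n) * squeeze_generator1 s f n)\<bar>"
    then have "\<bar>L\<bar> \<le> \<bar>s\<bar> * (real (N + 3) * G N)" using bound[of N] by linarith
    then have "1 / real (N + 3) \<le> \<bar>s\<bar> * G N / \<bar>L\<bar>"
      using L0 by (simp add: field_simps)
    then show "norm (inverse (real (N + 3))) \<le> \<bar>s\<bar> / \<bar>L\<bar> * G N" by (simp add: divide_inverse mult_ac)
  qed
  have "summable (\<lambda>N. inverse (real (N + 3)))"
    by (rule summable_comparison_test_ev[OF ev]) (intro summable_mult sG)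
  then have "summable (\<lambda>N. inverse (real N))" by (subst (asm) summable_iff_shift)
  then show False using not_summable_harmonic by blast
qed

section \<open>Conservation of the norm along orbits\<close>

lemma cmod_add_scaled_square:
  "(cmod (z + complex_of_real h * w))\<^sup>2 = (cmod z)\<^sup>2 + 2 * h * Re (cnj z * w) + h\<^sup>2 * (cmod w)\<^sup>2"
  by (cases z, cases w) (simp add: cmod_power2, simp add: power2_eq_square algebra_simps)

text \<open>Write \<open>f (t + h) = f t + h (a + e)\<close> with \<open>e\<close> tending to 0 in
  norm. In the squared norm the term linear in \<open>h\<close> that comes from \<open>a\<close>
  vanishes by \<open>skew\<close>; the remainder divided by \<open>h\<close> tends to 0 by
  Cauchy-Schwarz.\<close>

lemma norm_square_stationary:
  fixes f :: "real \<Rightarrow> 'a \<Rightarrow> complex"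
  assumes f: "\<And>t. (\<lambda>n. (cmod (f t n))\<^sup>2) summable_on UNIV"
    and a: "(\<lambda>n. (cmod (a n))\<^sup>2) summable_on UNIV"
    and skew: "Re (\<Sum>\<^sub>\<infinity>n. cnj (f t n) * a n) = 0"
    and lim: "((\<lambda>h. \<Sum>\<^sub>\<infinity>n. (cmod ((f (t + h) n - f t n) / complex_of_real h - a n))\<^sup>2) \<longlongrightarrow> 0) (at 0)"
  shows "((\<lambda>t. \<Sum>\<^sub>\<infinity>n. (cmod (f t n))\<^sup>2) has_real_derivative 0) (at t)"
proof -
  define e where "e h n = (f (t + h) n - f t n) / complex_of_real h - a n" for h n
  define g where "g t = (\<Sum>\<^sub>\<infinity>n. (cmod (f t n))\<^sup>2)" for t
  define E where "E h = (\<Sum>\<^sub>\<infinity>n. (cmod (e h n))\<^sup>2)" for h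
  define Ea where "Ea = (\<Sum>\<^sub>\<infinity>n. (cmod (a n))\<^sup>2)"
  have se: "(\<lambda>n. (cmod (e h n))\<^sup>2) summable_on UNIV" for h
    using square_summable_diff(1)[OF square_summable_scale[OF square_summable_diff(1)[OF f f],
        of "1 / complex_of_real h" "t + h" t] a]
    by (simp add: e_def)
  have bound: "\<bar>(g (t + h) - g t) / h\<bar> \<le> 2 * (sqrt (g t) * sqrt (E h)) + \<bar>h\<bar> * (2 * Ea + 2 * E h)" if "h \<noteq> 0" for h
  proof -
    have sae: "(\<lambda>n. (cmod (a n + e h n))\<^sup>2) summable_on UNIV"
      by (rule square_summable_add(1)[OF a se])
    have fa: "((\<lambda>n. Re (cnj (f t n) * a n)) has_sum 0) UNIV"
      using has_sum_Re[OF has_sum_infsum[OF infinite_sum_Cauchy_Schwarz(1)[OF f a]], of t] skew by simp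
    have fe: "((\<lambda>n. Re (cnj (f t n) * e h n)) has_sum Re (\<Sum>\<^sub>\<infinity>n. cnj (f t n) * e h n)) UNIV"
      by (intro has_sum_Re has_sum_infsum infinite_sum_Cauchy_Schwarz(1)[OF f se])
    have "((\<lambda>n. (cmod (f t n))\<^sup>2 + (2 * h * Re (cnj (f t n) * a n) + (2 * h * Re (cnj (f t n) * e h n)
         + h\<^sup>2 * (cmod (a n + e h n))\<^sup>2))) has_sum
       g t + (2 * h * 0 + (2 * h * Re (\<Sum>\<^sub>\<infinity>n. cnj (f t n) * e h n)
         + h\<^sup>2 * (\<Sum>\<^sub>\<infinity>n. (cmod (a n + e h n))\<^sup>2)))) UNIV"
      unfolding g_def by (intro has_sum_add has_sum_cmult_right fa fe has_sum_infsum f sae)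
    moreover have "(cmod (f t n))\<^sup>2 + (2 * h * Re (cnj (f t n) * a n) + (2 * h * Re (cnj (f t n) * e h n)
         + h\<^sup>2 * (cmod (a n + e h n))\<^sup>2)) = (cmod (f (t + h) n))\<^sup>2" for n
    proof -
      have "f (t + h) n = f t n + complex_of_real h * (a n + e h n)"
        using that by (simp add: e_def field_simps)
      then have "(cmod (f (t + h) n))\<^sup>2 = (cmod (f t n))\<^sup>2 + 2 * h * Re (cnj (f t n) * (a n + e h n)) + h\<^sup>2 * (cmod (a n + e h n))\<^sup>2"
        by (simp only: cmod_add_scaled_square)
      then show ?thesis by (simp add: algebra_simps)
    qed
    ultimately have "((\<lambda>n. (cmod (f (t + h) n))\<^sup>2) has_sum
       g t + (2 * h * Re (\<Sum>\<^sub>\<infinity>n. cnj (f t n) * e h n) + h\<^sup>2 * (\<Sum>\<^sub>\<infinity>n. (cmod (a n + e h n))\<^sup>2))) UNIV"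
      by simp
    then have "g (t + h) = g t + (2 * h * Re (\<Sum>\<^sub>\<infinity>n. cnj (f t n) * e h n) + h\<^sup>2 * (\<Sum>\<^sub>\<infinity>n. (cmod (a n + e h n))\<^sup>2))"
      unfolding g_def[of "t + h"] by (rule infsumI)
    then have "(g (t + h) - g t) / h = 2 * Re (\<Sum>\<^sub>\<infinity>n. cnj (f t n) * e h n) + h * (\<Sum>\<^sub>\<infinity>n. (cmod (a n + e h n))\<^sup>2)"
      using that by (simp add: field_simps power2_eq_square)
    moreover have "\<bar>Re (\<Sum>\<^sub>\<infinity>n. cnj (f t n) * e h n)\<bar> \<le> sqrt (g t) * sqrt (E h)"
      unfolding g_def E_def
      by (rule order_trans[OF abs_Re_le_cmod infinite_sum_Cauchy_Schwarz(2)[OF f se]])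
    moreover have "\<bar>h * (\<Sum>\<^sub>\<infinity>n. (cmod (a n + e h n))\<^sup>2)\<bar> \<le> \<bar>h\<bar> * (2 * Ea + 2 * E h)"
      unfolding abs_mult using square_summable_add(2)[OF a se, of h]
      by (intro mult_left_mono) (auto simp: Ea_def E_def infsum_nonneg)
    ultimately show ?thesis by linarith
  qed
  have "(E \<longlongrightarrow> 0) (at 0)" using lim by (simp add: E_def[abs_def] e_def)
  then have "((\<lambda>h. 2 * (sqrt (g t) * sqrt (E h)) + \<bar>h\<bar> * (2 * Ea + 2 * E h)) \<longlongrightarrow>
      2 * (sqrt (g t) * sqrt 0) + \<bar>0\<bar> * (2 * Ea + 2 * 0)) (at 0)"
    by (intro tendsto_intros)
  then have lim0: "((\<lambda>h. 2 * (sqrt (g t) * sqrt (E h)) + \<bar>h\<bar> * (2 * Ea + 2 * E h)) \<longlongrightarrow> 0) (at 0)"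
    by simp
  have "((\<lambda>h. (g (t + h) - g t) / h) \<longlongrightarrow> 0) (at 0)"
    using bound by (intro Lim_null_comparison[OF _ lim0]) (simp add: eventually_at_filter)
  then show ?thesis unfolding DERIV_def g_def by simp
qed

text \<open>Skewness is available for a single mode, so the difference of the orbits is restricted
  to a line of indices along which only the occupation of mode \<open>j\<close> varies. The
  generator maps each line to itself, and the squared norm on the line stays at its initial value
  0.\<close>

lemma orbit_unique:
  assumes u: "orbit (squeeze_generator s j) u" and v: "orbit (squeeze_generator s j) v" and "u 0 = v 0"
  shows "u t = v t"
proof
  fix m0
  define A where "A = squeeze_generator s j"
  define c where "c n = m0(j := n)" for n :: nat
  have inj: "inj c" unfolding c_def inj_def by (metis fun_upd_same)
  define f where "f t n = u t (c n) - v t (c n)" for t n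
  define Rem where "Rem w t h m = (w (t + h) m - w t m) / complex_of_real h - A (w t) m" for w :: "real \<Rightarrow> 'a amplitudes" and t h m
  have slice: "(\<lambda>n. (cmod (\<psi> (c n)))\<^sup>2) summable_on UNIV"
       "(\<Sum>\<^sub>\<infinity>n. (cmod (\<psi> (c n)))\<^sup>2) \<le> (fock_norm \<psi>)\<^sup>2" if "\<psi> \<in> fock_space" for \<psi>
  proof -
    have s: "(\<lambda>m. (cmod (\<psi> m))\<^sup>2) summable_on UNIV" using that by (simp add: fock_space_def)
    have s': "(\<lambda>m. (cmod (\<psi> m))\<^sup>2) summable_on range c" by (rule summable_on_subset[OF s]) auto
    then show "(\<lambda>n. (cmod (\<psi> (c n)))\<^sup>2) summable_on UNIV"
      by (subst (asm) summable_on_reindex[OF inj]) (simp add: o_def)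
    have "(\<Sum>\<^sub>\<infinity>n. (cmod (\<psi> (c n)))\<^sup>2) = (\<Sum>\<^sub>\<infinity>m\<in>range c. (cmod (\<psi> m))\<^sup>2)"
      by (subst infsum_reindex[OF inj]) (simp add: o_def)
    also have "\<dots> \<le> (\<Sum>\<^sub>\<infinity>m. (cmod (\<psi> m))\<^sup>2)"
      by (rule infsum_mono_neutral[OF s' s]) auto
    also have "\<dots> = (fock_norm \<psi>)\<^sup>2" by (simp add: fock_norm_def infsum_nonneg)
    finally show "(\<Sum>\<^sub>\<infinity>n. (cmod (\<psi> (c n)))\<^sup>2) \<le> (fock_norm \<psi>)\<^sup>2" .
  qed
  have uS: "u t \<in> fock_space" "A (u t) \<in> fock_space" and vS: "v t \<in> fock_space" "A (v t) \<in> fock_space" for t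
    using u v by (auto simp: orbit_def A_def)
  have limu: "((\<lambda>h. fock_norm (Rem u t h)) \<longlongrightarrow> 0) (at 0)" and limv: "((\<lambda>h. fock_norm (Rem v t h)) \<longlongrightarrow> 0) (at 0)" for t
    using u v by (simp_all add: orbit_def A_def Rem_def[abs_def])
  have Rem: "Rem w t h \<in> fock_space" if "\<And>t. w t \<in> fock_space" "\<And>t. A (w t) \<in> fock_space" for w t h
  proof -
    have "(\<lambda>m. (cmod (1 / complex_of_real h * (w (t + h) m - w t m) - A (w t) m))\<^sup>2) summable_on UNIV"
      using that by (intro square_summable_diff(1) square_summable_scale) (auto simp: fock_space_def)
    then show ?thesis by (simp add: fock_space_def Rem_def)
  qed
  have Af: "squeeze_generator1 s (f t) n = A (u t) (c n) - A (v t) (c n)" for t n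
    unfolding A_def c_def squeeze_generator_slice
    by (simp add: squeeze_generator1_def f_def c_def algebra_simps)
  have sf: "(\<lambda>n. (cmod (f t n))\<^sup>2) summable_on UNIV" for t
    unfolding f_def by (intro square_summable_diff(1) slice(1) uS vS)
  have sa: "(\<lambda>n. (cmod (squeeze_generator1 s (f t) n))\<^sup>2) summable_on UNIV" for t
    unfolding Af by (intro square_summable_diff(1) slice(1) uS vS)
  have "((\<lambda>t. \<Sum>\<^sub>\<infinity>n. (cmod (f t n))\<^sup>2) has_real_derivative 0) (at t)" for t
  proof (rule norm_square_stationary[OF sf sa squeeze_generator1_skew[OF sf sa]])
    have eq: "(f (t + h) n - f t n) / complex_of_real h - squeeze_generator1 s (f t) n = Rem u t h (c n) - Rem v t h (c n)" for h n
      unfolding Af f_def Rem_def by (simp add: diff_divide_distrib)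
    have le: "(\<Sum>\<^sub>\<infinity>n. (cmod (Rem u t h (c n) - Rem v t h (c n)))\<^sup>2) \<le> 2 * (fock_norm (Rem u t h))\<^sup>2 + 2 * (fock_norm (Rem v t h))\<^sup>2" for h
    proof -
      have R: "Rem u t h \<in> fock_space" "Rem v t h \<in> fock_space" by (intro Rem uS vS)+
      show ?thesis
        using square_summable_diff(2)[OF slice(1)[OF R(1)] slice(1)[OF R(2)]] slice(2)[OF R(1)] slice(2)[OF R(2)]
        by linarith
    qed
    have "((\<lambda>h. 2 * (fock_norm (Rem u t h))\<^sup>2 + 2 * (fock_norm (Rem v t h))\<^sup>2) \<longlongrightarrow> 2 * 0\<^sup>2 + 2 * 0\<^sup>2) (at 0)"
      by (intro tendsto_intros limu limv)
    then have lim0: "((\<lambda>h. 2 * (fock_norm (Rem u t h))\<^sup>2 + 2 * (fock_norm (Rem v t h))\<^sup>2) \<longlongrightarrow> 0) (at 0)"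
      by simp
    show "((\<lambda>h. \<Sum>\<^sub>\<infinity>n. (cmod ((f (t + h) n - f t n) / complex_of_real h - squeeze_generator1 s (f t) n))\<^sup>2) \<longlongrightarrow> 0) (at 0)"
      unfolding eq
      by (rule Lim_null_comparison[OF _ lim0], rule always_eventually) (simp add: infsum_nonneg le)
  qed
  then have "(\<Sum>\<^sub>\<infinity>n. (cmod (f t n))\<^sup>2) = (\<Sum>\<^sub>\<infinity>n. (cmod (f 0 n))\<^sup>2)"
    using DERIV_isconst_all by blast
  also have "\<dots> = 0" using assms(3) by (simp add: f_def)
  finally have "(cmod (f t (m0 j)))\<^sup>2 = 0"
    by (intro nonneg_infsum_le_0D[OF _ sf]) auto
  then show "u t m0 = v t m0" by (simp add: f_def c_def)
qed

lemma op_exp_eq: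
  assumes "orbit (squeeze_generator s j) u" and "u 0 = \<psi>"
  shows "op_exp (squeeze_generator s j) \<psi> = u 1"
  unfolding op_exp_def
proof (rule the_equality)
  fix \<phi> assume "\<exists>v. orbit (squeeze_generator s j) v \<and> v 0 = \<psi> \<and> v 1 = \<phi>"
  then show "\<phi> = u 1" using orbit_unique[OF assms(1)] assms(2) by metis
qed (use assms in blast)


section \<open>The squeezed vacuum\<close>

text \<open>At \<open>n = 2 k\<close> this is the familiar
  \<open>(- tanh s)^k sqrt ((2 k)!) / (2^k k!)\<close>, times the normalisation
  \<open>1 / sqrt (cosh s)\<close>.\<close>

fun squeezed_amp :: "real \<Rightarrow> nat \<Rightarrow> real" where
  "squeezed_amp s 0 = 1 / sqrt (cosh s)"
| "squeezed_amp s (Suc 0) = 0"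
| "squeezed_amp s (Suc (Suc n)) = - tanh s * sqrt ((real n + 1) / (real n + 2)) * squeezed_amp s n"

lemma squeezed_amp_unsqueezed: "squeezed_amp 0 n = (if n = 0 then 1 else 0)"
  by (induction "0::real" n rule: squeezed_amp.induct) auto

lemma squeezed_amp_odd: "odd n \<Longrightarrow> squeezed_amp s n = 0"
  by (induction s n rule: squeezed_amp.induct) auto

text \<open>One factor \<open>tanh s\<close> is gained for every two quanta, hence the square in the
  condition on the rate.\<close>

lemma squeezed_amp_bound:
  assumes "\<bar>tanh s\<bar> \<le> \<rho>\<^sup>2" "0 \<le> \<rho>"
  shows "\<bar>squeezed_amp s n\<bar> \<le> \<rho> ^ n"
  using assms(1)
proof (induction s n rule: squeezed_amp.induct)
  case (1 s)
  have "1 \<le> sqrt (cosh s)" using cosh_real_ge_1[of s] by simp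
  then show ?case by simp
next
  case (3 s n)
  have "\<bar>- tanh s * sqrt ((real n + 1) / (real n + 2)) * squeezed_amp s n\<bar>
      = \<bar>tanh s\<bar> * sqrt ((real n + 1) / (real n + 2)) * \<bar>squeezed_amp s n\<bar>"
    by (simp add: abs_mult)
  also have "\<dots> \<le> \<rho>\<^sup>2 * 1 * \<rho> ^ n"
    using 3 assms(2) by (intro mult_mono) auto
  finally show ?case by (simp add: power2_eq_square mult_ac)
qed (use assms(2) in auto)

lemma sqrt_ratio: "(real n + 2) * sqrt ((real n + 1) / (real n + 2)) = sqrt ((real n + 1) * (real n + 2))"
proof -
  define a b where "a = sqrt (real n + 1)" and "b = sqrt (real n + 2)"
  have b: "b * b = real n + 2" "b \<noteq> 0" by (auto simp: b_def)
  then have "(real n + 2) * (a / b) = a * b" by (simp flip: b(1))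
  then show ?thesis by (simp add: real_sqrt_divide real_sqrt_mult a_def b_def)
qed

text \<open>The squeezed vacuum is annihilated by \<open>cosh s a + sinh s a\<^sup>\<dagger>\<close>.\<close>

lemma squeezed_amp_lowering:
  "sqrt (real n + 1) * squeezed_amp s (n + 1) = - tanh s * (sqrt (real n) * squeezed_amp s (n - 1))"
proof (cases n)
  case (Suc k)
  have "sqrt (real k + 2) * sqrt ((real k + 1) / (real k + 2)) = sqrt (real k + 1)"
    by (simp add: real_sqrt_divide)
  then have "sqrt (real k + 2) * (sqrt ((real k + 1) / (real k + 2)) * (tanh s * squeezed_amp s k))
      = sqrt (real k + 1) * (tanh s * squeezed_amp s k)"
    by (simp only: mult.assoc[symmetric])
  with Suc show ?thesis by (simp add: mult_ac add_ac)
qed simp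

text \<open>The right-hand side is the one-mode squeeze generator of unit strength, so the squeezing
  parameter plays the role of time. With the raised amplitude rewritten by the recursion, an
  induction in steps of two only has to differentiate \<open>tanh\<close>.\<close>

lemma has_real_derivative_squeezed_amp:
  "((\<lambda>s. squeezed_amp s n) has_real_derivative
     (sqrt (real ((n + 1) * (n + 2))) * squeezed_amp s (n + 2)
      - sqrt (real (n * (n - 1))) * squeezed_amp s (n - 2)) / 2) (at s)"
proof -
  define t where "t = tanh s"
  define r where "r n = sqrt (real (n * (n - 1))) * squeezed_amp s (n - 2)" for n
  \<comment> \<open>Only the product with \<open>t\<close> is simplified: at zero squeezing
    \<open>t\<close> vanishes but \<open>r 2\<close> does not, so dividing by \<open>t\<close> is
    not possible.\<close>
  have tr: "t * r n = - (real n * squeezed_amp s n)" for n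
  proof (cases "n < 2")
    case False
    then obtain k where n: "n = Suc (Suc k)" by (metis add_2_eq_Suc less_eqE not_less)
    show ?thesis unfolding n r_def
      using sqrt_ratio[of k] by (simp add: t_def algebra_simps)
  qed (auto simp: r_def less_2_cases_iff)
  have up: "sqrt (real ((n + 1) * (n + 2))) * squeezed_amp s (n + 2) = - (real n + 1) * t * squeezed_amp s n" for n
  proof -
    have "sqrt (real ((n + 1) * (n + 2))) * sqrt ((real n + 1) / (real n + 2)) = real n + 1"
    proof -
      define a b where "a = sqrt (real n + 1)" and "b = sqrt (real n + 2)"
      have "b \<noteq> 0" "a * a = real n + 1" by (auto simp: a_def b_def)
      then have "a * b * (a / b) = real n + 1" by simp
      moreover have "sqrt (real ((n + 1) * (n + 2))) = a * b"
        unfolding of_nat_mult real_sqrt_mult by (simp add: a_def b_def add_ac)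
      ultimately show ?thesis by (simp add: real_sqrt_divide a_def b_def)
    qed
    moreover have "squeezed_amp s (n + 2) = - t * sqrt ((real n + 1) / (real n + 2)) * squeezed_amp s n"
      by (simp add: t_def)
    ultimately show ?thesis by (simp only: mult.commute mult.left_commute mult_minus_left mult_minus_right)
  qed
  have "((\<lambda>s. squeezed_amp s n) has_real_derivative (- (real n + 1) * t * squeezed_amp s n - r n) / 2) (at s)"
  proof (induction n rule: induct_nat_012)
    case 0
    have c: "(cosh has_real_derivative sinh s) (at s)" by (auto intro!: derivative_eq_intros)
    have "((\<lambda>s. sqrt (cosh s)) has_real_derivative inverse (sqrt (cosh s)) / 2 * sinh s) (at s)"
      using DERIV_chain2[OF DERIV_real_sqrt c] by simp
    then have "((\<lambda>s. inverse (sqrt (cosh s))) has_real_derivative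
        - (inverse (sqrt (cosh s)) * (inverse (sqrt (cosh s)) / 2 * sinh s) * inverse (sqrt (cosh s)))) (at s)"
      by (rule DERIV_inverse') simp
    moreover have "- (inverse (sqrt (cosh s)) * (inverse (sqrt (cosh s)) / 2 * sinh s) * inverse (sqrt (cosh s)))
        = - t * squeezed_amp s 0 / 2"
    proof -
      define w where "w = sqrt (cosh s)"
      have w: "w * w = cosh s" "w \<noteq> 0" by (auto simp: w_def)
      then have "t = sinh s / (w * w)" by (simp add: t_def tanh_def)
      with w(2) show ?thesis by (simp add: w_def[symmetric] field_simps)
    qed
    ultimately show ?case by (simp add: r_def inverse_eq_divide)
  next
    case 1
    show ?case by (simp add: r_def)
  next
    case (ge2 n)
    define \<alpha> where "\<alpha> = sqrt ((real n + 1) / (real n + 2))"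
    have "((\<lambda>s. - tanh s * \<alpha> * squeezed_amp s n) has_real_derivative
        - (1 - t\<^sup>2) * \<alpha> * squeezed_amp s n - t * \<alpha> * ((- (real n + 1) * t * squeezed_amp s n - r n) / 2)) (at s)"
      unfolding t_def
      by (rule derivative_eq_intros ge2(1)[unfolded t_def] refl | simp)+
    moreover have "- (1 - t\<^sup>2) * \<alpha> * squeezed_amp s n - t * \<alpha> * ((- (real n + 1) * t * squeezed_amp s n - r n) / 2)
        = (- (real (Suc (Suc n)) + 1) * t * squeezed_amp s (Suc (Suc n)) - r (Suc (Suc n))) / 2"
    proof -
      have r: "r (Suc (Suc n)) = (real n + 2) * \<alpha> * squeezed_amp s n"
        using sqrt_ratio[of n] by (simp add: r_def \<alpha>_def algebra_simps)
      have "- (1 - t\<^sup>2) * \<alpha> * squeezed_amp s n - t * \<alpha> * ((- (real n + 1) * t * squeezed_amp s n - r n) / 2)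
          = - (1 - t\<^sup>2) * \<alpha> * squeezed_amp s n + \<alpha> * ((real n + 1) * t\<^sup>2 * squeezed_amp s n + t * r n) / 2"
        by (simp add: power2_eq_square field_simps)
      also have "\<dots> = ((real n + 3) * t\<^sup>2 * \<alpha> * squeezed_amp s n - (real n + 2) * \<alpha> * squeezed_amp s n) / 2"
        unfolding tr by (simp add: field_simps)
      also have "\<dots> = (- (real (Suc (Suc n)) + 1) * t * squeezed_amp s (Suc (Suc n)) - r (Suc (Suc n))) / 2"
      proof -
        have "squeezed_amp s (Suc (Suc n)) = - t * \<alpha> * squeezed_amp s n" by (simp add: \<alpha>_def t_def)
        then show ?thesis unfolding r by (simp only:) (simp add: power2_eq_square field_simps)
      qed
      finally show ?thesis .
    qed
    ultimately show ?case by (simp only: \<alpha>_def squeezed_amp.simps)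
  qed
  then show ?thesis unfolding up r_def by simp
qed

section \<open>Product states and their squeezing orbits\<close>

definition squeezed :: "('n::finite \<Rightarrow> real) \<Rightarrow> 'n amplitudes" where
  "squeezed x m = complex_of_real (\<Prod>i\<in>UNIV. squeezed_amp (x i) (m i))"

lemma squeezed_unsqueezed: "squeezed (\<lambda>_. 0) = vacuum"
proof
  fix m :: "'n::finite \<Rightarrow> nat"
  show "squeezed (\<lambda>_. 0) m = vacuum m"
  proof (cases "m = (\<lambda>_. 0)")
    case False
    then obtain i where "m i \<noteq> 0" by blast
    then have "(\<Prod>i\<in>UNIV. squeezed_amp 0 (m i)) = 0"
      by (intro prod_zero) (auto simp: squeezed_amp_unsqueezed)
    with False show ?thesis by (simp add: squeezed_def vacuum_def)
  qed (simp add: squeezed_def vacuum_def squeezed_amp_unsqueezed)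
qed

lemma squeezed_upd:
  "squeezed (x(j := \<xi>)) (m(j := l)) =
     complex_of_real (squeezed_amp \<xi> l * (\<Prod>i\<in>UNIV - {j}. squeezed_amp (x i) (m i)))"
  by (simp add: squeezed_def prod.remove[of UNIV j])

lemma decay_squeezed:
  assumes "\<And>i. \<bar>tanh (x i)\<bar> \<le> \<rho>\<^sup>2" "0 \<le> \<rho>"
  shows "decay 1 \<rho> (squeezed x)"
  unfolding decay_def
proof
  fix m
  have "cmod (squeezed x m) = (\<Prod>i\<in>UNIV. \<bar>squeezed_amp (x i) (m i)\<bar>)"
    unfolding squeezed_def norm_of_real by (rule abs_prod)
  also have "\<dots> \<le> (\<Prod>i\<in>UNIV. \<rho> ^ m i)"
    using assms by (intro prod_mono conjI squeezed_amp_bound) auto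
  finally show "cmod (squeezed x m) \<le> 1 * \<rho> ^ quanta m" by (simp add: quanta_def power_sum)
qed

lemma tanh_bounded_rate:
  fixes R :: real
  assumes "0 \<le> R"
  obtains \<rho> where "0 < \<rho>" "\<rho> < 1" "\<And>y. \<bar>y\<bar> \<le> R \<Longrightarrow> \<bar>tanh y\<bar> \<le> \<rho>\<^sup>2"
proof
  \<comment> \<open>The rate is the midpoint of \<open>a\<close> and 1; its square is at least
    \<open>a\<close> because \<open>(1 - a)\<^sup>2 \<ge> 0\<close>.\<close>
  define a where "a = tanh R"
  have a: "0 \<le> a" "a < 1" using assms tanh_real_bounds[of R] by (auto simp: a_def)
  then show "0 < (1 + a) / 2" "(1 + a) / 2 < 1" by auto
  fix y :: real assume "\<bar>y\<bar> \<le> R"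
  then have "tanh \<bar>y\<bar> \<le> a" unfolding a_def by (simp only: tanh_real_le_iff)
  then have "\<bar>tanh y\<bar> \<le> a" by simp
  also have "a \<le> ((1 + a) / 2)\<^sup>2"
    using zero_le_power2[of "1 - a"] by (simp add: power2_eq_square field_simps)
  finally show "\<bar>tanh y\<bar> \<le> ((1 + a) / 2)\<^sup>2" .
qed

lemma decaying_squeezed: "decaying (squeezed x)"
proof -
  obtain \<rho> where \<rho>: "0 < \<rho>" "\<rho> < 1" "\<And>y. \<bar>y\<bar> \<le> (\<Sum>i\<in>UNIV. \<bar>x i\<bar>) \<Longrightarrow> \<bar>tanh y\<bar> \<le> \<rho>\<^sup>2"
    using tanh_bounded_rate[of "\<Sum>i\<in>UNIV. \<bar>x i\<bar>"] by (auto simp: sum_nonneg)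
  have "\<bar>x i\<bar> \<le> (\<Sum>i\<in>UNIV. \<bar>x i\<bar>)" for i by (rule member_le_sum) auto
  then have "decay 1 \<rho> (squeezed x)" using \<rho> by (intro decay_squeezed) auto
  then show ?thesis using \<rho> unfolding decaying_def by blast
qed

text \<open>Only the factor of mode \<open>j\<close> moves, and the product \<open>Q\<close> of the
  other factors is carried along as a constant. The derivative is that of a single amplitude;
  convergence in norm is a separate matter.\<close>

lemma has_vector_derivative_squeezed:
  "((\<lambda>\<tau>. squeezed (x(j := x j + s * \<tau>)) m) has_vector_derivative
     squeeze_generator s j (squeezed (x(j := x j + s * t))) m) (at t)"
proof -
  define Q where "Q = (\<Prod>i\<in>UNIV - {j}. squeezed_amp (x i) (m i))"
  define D where "D = (sqrt (real ((m j + 1) * (m j + 2))) * squeezed_amp (x j + s * t) (m j + 2)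
      - sqrt (real (m j * (m j - 1))) * squeezed_amp (x j + s * t) (m j - 2)) / 2"
  have sq: "squeezed (x(j := \<xi>)) (m(j := l)) = complex_of_real (squeezed_amp \<xi> l * Q)" for \<xi> l
    by (simp add: squeezed_upd Q_def)
  have lin: "((\<lambda>\<tau>. x j + s * \<tau>) has_real_derivative s) (at t)"
    by (auto intro!: derivative_eq_intros)
  have "((\<lambda>\<tau>. squeezed_amp (x j + s * \<tau>) (m j)) has_real_derivative D * s) (at t)"
    unfolding D_def by (rule DERIV_chain2[OF has_real_derivative_squeezed_amp lin])
  then have "((\<lambda>\<tau>. squeezed_amp (x j + s * \<tau>) (m j) * Q) has_real_derivative D * s * Q) (at t)"
    by (rule DERIV_cmult_right)
  then have "((\<lambda>\<tau>. complex_of_real (squeezed_amp (x j + s * \<tau>) (m j) * Q)) has_vector_derivative complex_of_real (D * s * Q)) (at t)"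
    by (intro has_vector_derivative_of_real) (simp add: has_real_derivative_iff_has_vector_derivative)
  moreover have "squeeze_generator s j (squeezed (x(j := x j + s * t))) m = complex_of_real (D * s * Q)"
  proof -
    have "squeeze_generator s j (squeezed (x(j := x j + s * t))) m = complex_of_real (s / 2 *
        (sqrt (real ((m j + 1) * (m j + 2))) * (squeezed_amp (x j + s * t) (m j + 2) * Q)
         - sqrt (real (m j * (m j - 1))) * (squeezed_amp (x j + s * t) (m j - 2) * Q)))"
      using squeeze_generator_slice[of s j "squeezed (x(j := x j + s * t))" m "m j"]
      by (simp only: sq squeeze_generator1_def of_real_mult of_real_diff fun_upd_triv)
    also have "s / 2 *
        (sqrt (real ((m j + 1) * (m j + 2))) * (squeezed_amp (x j + s * t) (m j + 2) * Q)
         - sqrt (real (m j * (m j - 1))) * (squeezed_amp (x j + s * t) (m j - 2) * Q)) = D * s * Q"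
    proof -
      have "s / 2 * (P * (a * Q) - P' * (a' * Q)) = (P * a - P' * a') / 2 * s * Q" for P P' a a' :: real
        by (simp add: field_simps)
      then show ?thesis unfolding D_def .
    qed
    finally show ?thesis .
  qed
  ultimately show ?thesis using sq[of _ "m j"] by simp
qed

text \<open>At a fixed index the generator combines just two amplitudes, so it commutes with
  amplitude-wise differentiation.\<close>

lemma has_vector_derivative_squeeze_generator:
  assumes "\<And>m. ((\<lambda>\<tau>. w \<tau> m) has_vector_derivative w' m) (at t)"
  shows "((\<lambda>\<tau>. squeeze_generator s j (w \<tau>) m) has_vector_derivative squeeze_generator s j w' m) (at t)"
  unfolding squeeze_generator_def annihilate_def create_def
  by (intro has_vector_derivative_mult_right has_vector_derivative_diff assms)

text \<open>The mean value bound is applied twice, first to \<open>f'\<close> and then to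
  \<open>f\<close> minus its linear part; this gives twice the sharp constant.\<close>

lemma second_order_remainder:
  fixes f f' f'' :: "real \<Rightarrow> 'a::real_normed_vector"
  assumes f: "\<And>x. (f has_vector_derivative f' x) (at x)"
    and f': "\<And>x. (f' has_vector_derivative f'' x) (at x)"
    and B: "\<And>x. \<bar>x - t\<bar> \<le> \<bar>h\<bar> \<Longrightarrow> norm (f'' x) \<le> B"
  shows "norm (f (t + h) - f t - h *\<^sub>R f' t) \<le> h\<^sup>2 * B"
proof -
  let ?S = "closed_segment t (t + h)"
  have S: "\<bar>x - t\<bar> \<le> \<bar>h\<bar>" if "x \<in> ?S" for x
    using that segment_bound1[of x t "t + h"] by (auto simp: norm_minus_commute)
  have "norm (f' x - f' t) \<le> \<bar>h\<bar> * B" if "x \<in> ?S" for x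
  proof -
    have "norm (f' x - f' t) \<le> B * norm (x - t)"
    proof (rule differentiable_bound[of ?S f' "\<lambda>x h. h *\<^sub>R f'' x"])
      show "(f' has_derivative (\<lambda>h. h *\<^sub>R f'' x)) (at x within ?S)" for x
        using has_derivative_at_withinI f'[of x] unfolding has_vector_derivative_def by blast
      show "onorm (\<lambda>h. h *\<^sub>R f'' x) \<le> B" if "x \<in> ?S" for x
        using B[OF S[OF that]] order_trans[OF norm_ge_zero B[OF S[OF that]]]
        by (intro onorm_bound) (auto simp: mult.commute[of B] intro: mult_left_mono)
    qed (use that in auto)
    also have "\<dots> \<le> B * \<bar>h\<bar>"
      using S[OF that] order_trans[OF norm_ge_zero B[of t]] by (intro mult_left_mono) auto
    finally show ?thesis by (simp add: mult.commute)
  qed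
  then have "norm (f (t + h) - f t - (t + h - t) *\<^sub>R f' t) \<le> norm (t + h - t) * (\<bar>h\<bar> * B)"
    using f by (intro vector_differentiable_bound_linearization[where S = ?S])
      (auto intro: has_vector_derivative_at_within)
  then show ?thesis by (simp add: power2_eq_square mult.assoc[symmetric])
qed

text \<open>The second time derivative of the amplitudes is \<open>A (A (u \<tau>))\<close>, which
  decays geometrically, uniformly for \<tau> near \<open>t\<close>. By the second-order remainder
  the error of the difference quotient is at most \<open>\<bar>h\<bar>\<close> times a fixed
  square-summable family, so its norm tends to 0.\<close>

lemma orbit_squeezed:
  "orbit (squeeze_generator s j) (\<lambda>t. squeezed (x(j := x j + s * t)))"
  unfolding orbit_def
proof (intro allI conjI)
  fix t
  define u where "u = (\<lambda>t. squeezed (x(j := x j + s * t)))"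
  define A where "A = squeeze_generator s j"
  \<comment> \<open>Bounds every squeezing parameter of \<open>u \<tau>\<close> while
    \<open>\<bar>\<tau> - t\<bar> \<le> 1\<close>, so that one rate \<rho> serves all these
    states.\<close>
  define R where "R = (\<Sum>i\<in>UNIV. \<bar>x i\<bar>) + \<bar>s\<bar> * (\<bar>t\<bar> + 1)"
  obtain \<rho> where \<rho>: "0 < \<rho>" "\<rho> < 1" "\<And>y. \<bar>y\<bar> \<le> R \<Longrightarrow> \<bar>tanh y\<bar> \<le> \<rho>\<^sup>2"
    using tanh_bounded_rate[of R] by (auto simp: R_def sum_nonneg)
  have u: "decay 1 \<rho> (u \<tau>)" if "\<bar>\<tau> - t\<bar> \<le> 1" for \<tau>
    unfolding u_def
  proof (intro decay_squeezed \<rho>(3))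
    fix i
    have xi: "\<bar>x i\<bar> \<le> (\<Sum>i\<in>UNIV. \<bar>x i\<bar>)" for i by (rule member_le_sum) auto
    have "\<bar>s * \<tau>\<bar> \<le> \<bar>s\<bar> * (\<bar>t\<bar> + 1)"
      unfolding abs_mult using that by (intro mult_left_mono) auto
    moreover have "0 \<le> \<bar>s\<bar> * (\<bar>t\<bar> + 1)" by simp
    ultimately show "\<bar>(x(j := x j + s * \<tau>)) i\<bar> \<le> R"
      using xi[of i] xi[of j] unfolding R_def fun_upd_def by (auto split: if_splits)
  qed (use \<rho> in auto)
  obtain L \<sigma> where L: "0 < \<sigma>" "\<sigma> < 1" "\<And>\<psi>::'a amplitudes. decay 1 \<rho> \<psi> \<Longrightarrow> decay L \<sigma> (A \<psi>)"
    by (rule decay_squeeze_generator[OF \<rho>(1,2) zero_le_one, of s j, folded A_def]) rule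
  have At: "decay L \<sigma> (A (u t))" by (intro L u) simp
  obtain M \<eta> where M: "0 < \<eta>" "\<eta> < 1" "\<And>\<psi>::'a amplitudes. decay L \<sigma> \<psi> \<Longrightarrow> decay M \<eta> (A \<psi>)"
    by (rule decay_squeeze_generator[OF L(1,2) decay_nonneg[OF At], of s j, folded A_def]) rule
  show "squeezed (x(j := x j + s * t)) \<in> fock_space" "squeeze_generator s j (squeezed (x(j := x j + s * t))) \<in> fock_space"
    using decay_square_summable(1)[OF \<rho>(1,2) u[of t]] decay_square_summable(1)[OF L(1,2) At]
    by (simp_all add: fock_space_def u_def A_def)
  have du: "((\<lambda>\<tau>. u \<tau> m) has_vector_derivative A (u \<tau>) m) (at \<tau>)" for \<tau> m
    unfolding u_def A_def by (rule has_vector_derivative_squeezed)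
  have dAu: "((\<lambda>\<tau>. A (u \<tau>) m) has_vector_derivative A (A (u \<tau>)) m) (at \<tau>)" for \<tau> m
    using du unfolding A_def by (rule has_vector_derivative_squeeze_generator)
  define G where "G = sqrt (\<Sum>\<^sub>\<infinity>m::'a\<Rightarrow>nat. (\<eta>\<^sup>2) ^ quanta m)"
  have "norm (fock_norm (\<lambda>m. (u (t + h) m - u t m) / complex_of_real h - A (u t) m)) \<le> \<bar>h\<bar> * M * G"
    if h: "h \<noteq> 0" "\<bar>h\<bar> \<le> 1" for h
  proof -
    have "decay (\<bar>h\<bar> * M) \<eta> (\<lambda>m. (u (t + h) m - u t m) / complex_of_real h - A (u t) m)"
      unfolding decay_def
    proof
      fix m
      have "cmod (A (A (u \<tau>)) m) \<le> M * \<eta> ^ quanta m" if "\<bar>\<tau> - t\<bar> \<le> \<bar>h\<bar>" for \<tau>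
        using M(3)[OF L(3)[OF u[of \<tau>]]] that h(2) by (auto simp: decay_def)
      then have "cmod (u (t + h) m - u t m - h *\<^sub>R A (u t) m) \<le> h\<^sup>2 * (M * \<eta> ^ quanta m)"
        by (rule second_order_remainder[OF du dAu])
      then have "cmod (u (t + h) m - u t m - h *\<^sub>R A (u t) m) / \<bar>h\<bar> \<le> \<bar>h\<bar> * M * \<eta> ^ quanta m"
        using h(1) by (simp add: field_simps power2_eq_square)
      moreover have "cmod ((u (t + h) m - u t m) / complex_of_real h - A (u t) m)
          = cmod (u (t + h) m - u t m - h *\<^sub>R A (u t) m) / \<bar>h\<bar>"
      proof -
        have "(u (t + h) m - u t m) / complex_of_real h - A (u t) m
            = (u (t + h) m - u t m - h *\<^sub>R A (u t) m) / complex_of_real h"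
          using h(1) by (simp add: diff_divide_distrib scaleR_conv_of_real)
        then show ?thesis by (simp add: norm_divide)
      qed
      ultimately show "cmod ((u (t + h) m - u t m) / complex_of_real h - A (u t) m) \<le> \<bar>h\<bar> * M * \<eta> ^ quanta m"
        by simp
    qed
    from decay_square_summable(2)[OF M(1,2) this] show ?thesis
      by (simp add: G_def fock_norm_def infsum_nonneg)
  qed
  then have "\<forall>\<^sub>F h in at 0. norm (fock_norm (\<lambda>m. (u (t + h) m - u t m) / complex_of_real h - A (u t) m)) \<le> \<bar>h\<bar> * M * G"
    unfolding eventually_at by (intro exI[of _ 1]) auto
  moreover have "((\<lambda>h. \<bar>h\<bar> * M * G) \<longlongrightarrow> 0) (at 0)"
    by (auto intro!: tendsto_eq_intros)
  ultimately have "((\<lambda>h. fock_norm (\<lambda>m. (u (t + h) m - u t m) / complex_of_real h - A (u t) m)) \<longlongrightarrow> 0) (at 0)"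
    by (rule Lim_null_comparison)
  then show "((\<lambda>h. fock_norm (\<lambda>m. (squeezed (x(j := x j + s * (t + h))) m - squeezed (x(j := x j + s * t)) m) / complex_of_real h
      - squeeze_generator s j (squeezed (x(j := x j + s * t))) m)) \<longlongrightarrow> 0) (at 0)"
    by (simp only: u_def A_def)
qed

lemma op_exp_squeezed:
  "op_exp (squeeze_generator s j) (squeezed x) = squeezed (x(j := x j + s))"
  using op_exp_eq[OF orbit_squeezed, of x j s] by simp

lemma probe_eq_squeezed: "probe r = squeezed (\<lambda>i. r $ i)"
proof -
  \<comment> \<open>As the modes are distinct, each factor acts on a mode that is still unsqueezed
    and raises its parameter from 0 to \<open>r $ j\<close>.\<close>
  have "foldr (\<lambda>j. op_exp (squeeze_generator (r $ j) j)) js vacuum = squeezed (\<lambda>i. if i \<in> set js then r $ i else 0)"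
    if "distinct js" for js
    using that
  proof (induction js)
    case (Cons j js)
    then have "foldr (\<lambda>j. op_exp (squeeze_generator (r $ j) j)) (j # js) vacuum
        = squeezed ((\<lambda>i. if i \<in> set js then r $ i else 0)(j := r $ j))"
      by (simp add: op_exp_squeezed)
    also have "(\<lambda>i. if i \<in> set js then r $ i else 0)(j := r $ j) = (\<lambda>i. if i \<in> set (j # js) then r $ i else 0)"
      by auto
    finally show ?case .
  qed (simp add: squeezed_unsqueezed)
  from this[of "sorted_list_of_set UNIV"] show ?thesis
    by (simp add: probe_def squeeze_def)
qed


section \<open>Passive generators on the squeezed vacuum\<close>

lemma fock_inner_commute: "fock_inner \<psi> \<phi> = cnj (fock_inner \<phi> \<psi>)"
  unfolding fock_inner_def infsum_cnj[symmetric] by (simp add: mult.commute)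

lemma fock_inner_scale_right: "fock_inner \<phi> (\<lambda>m. c * \<psi> m) = c * fock_inner \<phi> \<psi>"
  unfolding fock_inner_def by (simp add: infsum_cmult_right'[symmetric] mult_ac)

lemma fock_inner_scale_left: "fock_inner (\<lambda>m. c * \<phi> m) \<psi> = cnj c * fock_inner \<phi> \<psi>"
  unfolding fock_inner_def by (simp add: infsum_cmult_right'[symmetric] mult_ac)

lemma fock_inner_add_right:
  assumes "decaying \<phi>" "decaying \<psi>" "decaying \<eta>"
  shows "fock_inner \<phi> (\<lambda>m. \<psi> m + \<eta> m) = fock_inner \<phi> \<psi> + fock_inner \<phi> \<eta>"
  unfolding fock_inner_def distrib_left using assms by (intro infsum_add decaying_inner_summable)

lemma fock_inner_add_left:
  assumes "decaying \<phi>" "decaying \<psi>" "decaying \<eta>"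
  shows "fock_inner (\<lambda>m. \<phi> m + \<psi> m) \<eta> = fock_inner \<phi> \<eta> + fock_inner \<psi> \<eta>"
  using fock_inner_add_right[OF assms(3,1,2)] by (subst (1 2 3) fock_inner_commute) simp

lemma fock_inner_diff_right:
  assumes "decaying \<phi>" "decaying \<psi>" "decaying \<eta>"
  shows "fock_inner \<phi> (\<lambda>m. \<psi> m - \<eta> m) = fock_inner \<phi> \<psi> - fock_inner \<phi> \<eta>"
  using fock_inner_add_right[OF assms(1,2) decaying_scale[OF assms(3), of "- 1"]]
    fock_inner_scale_right[of \<phi> "- 1" \<eta>] by simp

text \<open>Raising \<open>m j\<close> by one carries one sum into the other. The indices with
  \<open>m j = 0\<close>, missed by the shift, contribute nothing because the prefactor of
  \<open>create\<close> is 0 there. Being a reindexing, the identity holds whether or not the sums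
  converge.\<close>

lemma fock_inner_annihilate: "fock_inner \<phi> (annihilate j \<psi>) = fock_inner (create j \<phi>) \<psi>"
proof -
  define h where "h m = m(j := m j + 1)" for m :: "'a \<Rightarrow> nat"
  have inj: "inj h"
  proof (rule injI)
    fix m m' assume eq: "h m = h m'"
    show "m = m'"
    proof
      fix i
      show "m i = m' i" using fun_cong[OF eq, of i] by (cases "i = j") (auto simp: h_def)
    qed
  qed
  have "fock_inner \<phi> (annihilate j \<psi>) = (\<Sum>\<^sub>\<infinity>m. cnj (create j \<phi> (h m)) * \<psi> (h m))"
    unfolding fock_inner_def by (intro infsum_cong) (simp add: annihilate_def create_def h_def)
  also have "\<dots> = (\<Sum>\<^sub>\<infinity>m\<in>range h. cnj (create j \<phi> m) * \<psi> m)"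
    by (subst infsum_reindex[OF inj]) (simp add: o_def)
  also have "\<dots> = (\<Sum>\<^sub>\<infinity>m. cnj (create j \<phi> m) * \<psi> m)"
  proof (rule infsum_cong_neutral)
    fix m assume "m \<in> UNIV - range h"
    moreover have "m = h (m(j := m j - 1))" if "m j \<noteq> 0" using that by (auto simp: h_def)
    ultimately have "m j = 0" by blast
    then show "cnj (create j \<phi> m) * \<psi> m = 0" by (simp add: create_def)
  qed auto
  finally show ?thesis by (simp add: fock_inner_def)
qed

lemma fock_inner_create: "fock_inner \<phi> (create j \<psi>) = fock_inner (annihilate j \<phi>) \<psi>"
  by (metis fock_inner_annihilate fock_inner_commute)

lemma bsX_eq: "bsX j k \<psi> = (\<lambda>m. create j (annihilate k \<psi>) m + create k (annihilate j \<psi>) m)"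
  by (simp add: bsX_def[abs_def])

lemma bsY_eq: "bsY j k \<psi> = (\<lambda>m. - \<i> * create j (annihilate k \<psi>) m + \<i> * create k (annihilate j \<psi>) m)"
  by (simp add: bsY_def[abs_def] algebra_simps)

lemma decaying_generator: "decaying \<psi> \<Longrightarrow> decaying (generator \<mu> \<psi>)"
proof -
  assume \<psi>: "decaying \<psi>"
  have "decaying (bsX j k \<psi>)" for j k
    unfolding bsX_eq by (intro decaying_add decaying_ladder \<psi>)
  moreover have "decaying (bsY j k \<psi>)" for j k
    unfolding bsY_eq by (intro decaying_add decaying_scale decaying_ladder \<psi>)
  ultimately show ?thesis by (cases \<mu>) (simp add: rot_def decaying_ladder \<psi>)
qed

text \<open>Taking adjoints exchanges the two hopping terms of a beam splitter, and conjugation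
  exchanges the prefactors \<open>- \<i>\<close> and \<open>\<i>\<close> of Y. Decay serves to split
  the inner products over the summands.\<close>

lemma generator_symmetric:
  assumes "decaying \<phi>" "decaying \<psi>"
  shows "fock_inner \<phi> (generator \<mu> \<psi>) = fock_inner (generator \<mu> \<phi>) \<psi>"
proof -
  have hop: "fock_inner \<phi> (create j (annihilate k \<psi>)) = fock_inner (create k (annihilate j \<phi>)) \<psi>" for j k
    by (simp add: fock_inner_create fock_inner_annihilate)
  have X: "fock_inner \<phi> (bsX j k \<psi>) = fock_inner (bsX j k \<phi>) \<psi>" for j k
    unfolding bsX_eq using assms
    by (simp add: fock_inner_add_right fock_inner_add_left decaying_ladder hop)
  have Y: "fock_inner \<phi> (bsY j k \<psi>) = fock_inner (bsY j k \<phi>) \<psi>" for j k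
    unfolding bsY_eq fock_inner_add_right[OF assms(1) decaying_scale decaying_scale, OF decaying_ladder(2) decaying_ladder(2), OF decaying_ladder(1) decaying_ladder(1), OF assms(2,2)]
      fock_inner_add_left[OF decaying_scale decaying_scale, OF decaying_ladder(2) decaying_ladder(2), OF decaying_ladder(1) decaying_ladder(1), OF assms(1,1,2)]
      fock_inner_scale_right fock_inner_scale_left hop by simp
  show ?thesis by (cases \<mu>) (simp add: rot_def X Y hop)
qed

section \<open>Tangent vectors as multiples of pair states\<close>

lemma create_scale: "create j (\<lambda>m. c * \<psi> m) m = c * create j \<psi> m"
  by (simp add: create_def)

lemma create_commute: "create j (create k \<psi>) = create k (create j \<psi>)"
  by (cases "j = k") (auto simp: create_def fun_eq_iff fun_upd_twist)

lemma annihilate_squeezed: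
  "annihilate j (squeezed x) = (\<lambda>m. - complex_of_real (tanh (x j)) * create j (squeezed x) m)"
proof
  fix m
  define Q where "Q = (\<Prod>i\<in>UNIV - {j}. squeezed_amp (x i) (m i))"
  have sq: "squeezed x (m(j := l)) = complex_of_real (squeezed_amp (x j) l * Q)" for l
    using squeezed_upd[of x j "x j" m l] by (simp add: Q_def)
  have "annihilate j (squeezed x) m = complex_of_real (sqrt (real (m j) + 1) * squeezed_amp (x j) (m j + 1) * Q)"
    by (simp add: annihilate_def sq del: squeezed_amp.simps)
  also have "\<dots> = - complex_of_real (tanh (x j)) * create j (squeezed x) m"
    unfolding squeezed_amp_lowering by (simp add: create_def sq)
  finally show "annihilate j (squeezed x) m = - complex_of_real (tanh (x j)) * create j (squeezed x) m" .
qed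

lemma create_annihilate_squeezed:
  "create j (annihilate k (squeezed x)) m = - complex_of_real (tanh (x k)) * create j (create k (squeezed x)) m"
  unfolding annihilate_squeezed by (rule create_scale)

definition pair_state :: "('n::finite \<Rightarrow> real) \<Rightarrow> 'n \<times> 'n \<Rightarrow> 'n amplitudes" where
  "pair_state x \<mu> = create (fst \<mu>) (create (snd \<mu>) (squeezed x))"

text \<open>The last branch belongs to \<open>bsY\<close> with the two modes exchanged, which is the
  origin of the sign of \<open>s - t\<close>.\<close>

definition pair_coeff :: "('n::linorder \<Rightarrow> real) \<Rightarrow> 'n \<times> 'n \<Rightarrow> complex" where
  "pair_coeff x \<mu> = (let s = tanh (x (fst \<mu>)); t = tanh (x (snd \<mu>)) in
     if fst \<mu> = snd \<mu> then - complex_of_real s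
     else if fst \<mu> < snd \<mu> then - complex_of_real (s + t) else \<i> * complex_of_real (s - t))"

lemma generator_squeezed:
  "generator \<mu> (squeezed x) = (\<lambda>m. pair_coeff x \<mu> * pair_state x \<mu> m)"
proof -
  obtain j k where \<mu>: "\<mu> = (j, k)" by (cases \<mu>)
  show ?thesis
    unfolding \<mu> pair_state_def pair_coeff_def
    by (auto simp: Let_def fun_eq_iff rot_def bsX_def bsY_def create_annihilate_squeezed create_commute[of k j]
        algebra_simps)
qed

lemma pair_state_swap: "pair_state x (k, j) = pair_state x (j, k)"
  by (simp add: pair_state_def create_commute)

lemma decaying_pair_state: "decaying (pair_state x \<mu>)"
  by (simp add: pair_state_def decaying_ladder decaying_squeezed)

text \<open>The amplitudes of pair states are real, so \<open>Re\<close> loses nothing, and all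
  phases of the Gram matrix sit in \<open>pair_coeff\<close>.\<close>

definition overlap :: "('n::finite \<Rightarrow> real) \<Rightarrow> 'n \<times> 'n \<Rightarrow> 'n \<times> 'n \<Rightarrow> real" where
  "overlap x \<mu> \<nu> = Re (fock_inner (pair_state x \<mu>) (pair_state x \<nu>))"

lemma cnj_pair_state: "cnj (pair_state x \<mu> m) = pair_state x \<mu> m"
  by (simp add: pair_state_def create_def squeezed_def)

lemma fock_inner_pair_state:
  "fock_inner (pair_state x \<mu>) (pair_state x \<nu>) = complex_of_real (overlap x \<mu> \<nu>)"
proof -
  have "cnj (fock_inner (pair_state x \<mu>) (pair_state x \<nu>)) = fock_inner (pair_state x \<mu>) (pair_state x \<nu>)"
    unfolding fock_inner_def infsum_cnj[symmetric] by (simp add: cnj_pair_state)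
  then show ?thesis by (simp add: overlap_def complex_eq_iff)
qed

lemma overlap_commute: "overlap x \<mu> \<nu> = overlap x \<nu> \<mu>"
  unfolding overlap_def by (subst fock_inner_commute) simp

lemma fock_inner_generator:
  "fock_inner (generator \<mu> (squeezed x)) (generator \<nu> (squeezed x)) =
     cnj (pair_coeff x \<mu>) * pair_coeff x \<nu> * complex_of_real (overlap x \<mu> \<nu>)"
  by (simp add: generator_squeezed fock_inner_scale_left fock_inner_scale_right fock_inner_pair_state)

section \<open>Parity selection rules\<close>

lemma squeezed_parity: "squeezed x m \<noteq> 0 \<Longrightarrow> even (m i)"
  using squeezed_amp_odd by (fastforce simp: squeezed_def)

lemma create_parity:
  assumes "\<And>m. \<psi> m \<noteq> 0 \<Longrightarrow> odd (m i) \<longleftrightarrow> P" and "create j \<psi> m \<noteq> 0"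
  shows "odd (m i) \<longleftrightarrow> P \<noteq> (i = j)"
proof -
  have "m j \<noteq> 0" "\<psi> (m(j := m j - 1)) \<noteq> 0" using assms(2) by (auto simp: create_def)
  with assms(1)[of "m(j := m j - 1)"] show ?thesis by (auto split: if_splits)
qed

text \<open>The squeezed vacuum has even occupations only, and each creation operator flips the
  parity of its mode; for \<open>j = k\<close> the two flips cancel.\<close>

lemma pair_state_parity:
  assumes "pair_state x (j, k) m \<noteq> 0" shows "odd (m i) \<longleftrightarrow> (i = j) \<noteq> (i = k)"
proof -
  have "odd (m i) \<longleftrightarrow> ((False \<noteq> (i = k)) \<noteq> (i = j))"
  proof (rule create_parity)
    show "create j (create k (squeezed x)) m \<noteq> 0" using assms by (simp add: pair_state_def)
    show "odd (m i) \<longleftrightarrow> (False \<noteq> (i = k))" if "create k (squeezed x) m \<noteq> 0" for m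
      using that squeezed_parity by (intro create_parity[of "squeezed x"]) auto
  qed
  then show ?thesis by blast
qed

lemma fock_inner_zero:
  assumes "\<And>m. \<phi> m = 0 \<or> \<psi> m = 0" shows "fock_inner \<phi> \<psi> = 0"
proof -
  have "(\<lambda>m. cnj (\<phi> m) * \<psi> m) = (\<lambda>m. 0)" using assms by (auto simp: fun_eq_iff)
  then show ?thesis unfolding fock_inner_def by (simp only: infsum_0_simp)
qed

text \<open>For distinct modes the common parity pattern determines the unordered pair. Two
  rotations share the all-even pattern, so their overlap is not excluded here; their commutator
  entry vanishes because both coefficients are real.\<close>

lemma overlap_nonzero_parity:
  assumes "overlap x (j, k) (l, m) \<noteq> 0"
  shows "((i = j) \<noteq> (i = k)) \<longleftrightarrow> ((i = l) \<noteq> (i = m))"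
proof -
  have "fock_inner (pair_state x (j, k)) (pair_state x (l, m)) \<noteq> 0"
    using assms by (auto simp: overlap_def)
  then obtain f where "pair_state x (j, k) f \<noteq> 0" "pair_state x (l, m) f \<noteq> 0"
    using fock_inner_zero by metis
  then show ?thesis using pair_state_parity by metis
qed

lemma fock_inner_squeezed_generator:
  assumes "j \<noteq> k" shows "fock_inner (squeezed x) (generator (j, k) (squeezed x)) = 0"
proof (rule fock_inner_zero)
  fix m
  show "squeezed x m = 0 \<or> generator (j, k) (squeezed x) m = 0"
    unfolding generator_squeezed
    using squeezed_parity[of x m j] pair_state_parity[of x j k m j] assms by auto
qed

lemma overlap_pos:
  assumes "j \<noteq> k" shows "0 < overlap x (j, k) (j, k)"
proof -
  have s: "(\<lambda>m. (cmod (pair_state x (j, k) m))\<^sup>2) summable_on UNIV"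
    by (intro decaying_square_summable decaying_pair_state)
  have "fock_inner (pair_state x (j, k)) (pair_state x (j, k)) = (\<Sum>\<^sub>\<infinity>m. complex_of_real ((cmod (pair_state x (j, k) m))\<^sup>2))"
    unfolding fock_inner_def complex_norm_square by (simp add: mult.commute)
  also have "\<dots> = complex_of_real (\<Sum>\<^sub>\<infinity>m. (cmod (pair_state x (j, k) m))\<^sup>2)"
    by (rule infsumI, rule has_sum_of_real) (rule has_sum_infsum[OF s])
  finally have eq: "overlap x (j, k) (j, k) = (\<Sum>\<^sub>\<infinity>m. (cmod (pair_state x (j, k) m))\<^sup>2)"
    by (simp add: overlap_def)
  \<comment> \<open>With one quantum in each of \<open>j\<close> and \<open>k\<close>, the pair
    state has the vacuum amplitude of \<open>squeezed x\<close>, an inverse product of factors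
    \<open>sqrt (cosh (x i))\<close>.\<close>
  define m where "m = (\<lambda>i. if i = j \<or> i = k then 1 else 0 :: nat)"
  have "m(j := 0, k := 0) = (\<lambda>_. 0)" by (auto simp: m_def)
  then have "pair_state x (j, k) m = squeezed x (\<lambda>_. 0)"
    using assms by (simp add: pair_state_def create_def m_def)
  moreover have "squeezed x (\<lambda>_. 0) \<noteq> 0" by (simp add: squeezed_def)
  ultimately have "(cmod (pair_state x (j, k) m))\<^sup>2 \<noteq> 0" by simp
  then have "(\<Sum>\<^sub>\<infinity>m. (cmod (pair_state x (j, k) m))\<^sup>2) \<noteq> 0"
    using nonneg_infsum_le_0D[OF _ s, of m] by auto
  moreover have "0 \<le> (\<Sum>\<^sub>\<infinity>m. (cmod (pair_state x (j, k) m))\<^sup>2)" by (simp add: infsum_nonneg)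
  ultimately show ?thesis unfolding eq by simp
qed

section \<open>Entries of the commutator, Fisher and Gram matrices\<close>

lemma mean_generator_generator:
  "mean r (\<lambda>\<psi>. generator \<mu> (generator \<nu> \<psi>)) =
     cnj (pair_coeff (($) r) \<mu>) * pair_coeff (($) r) \<nu> * complex_of_real (overlap (($) r) \<mu> \<nu>)"
  unfolding mean_def probe_eq_squeezed
  by (simp add: generator_symmetric decaying_squeezed decaying_generator fock_inner_generator[symmetric])

lemma mean_commutator_entry:
  "mean_commutator r $ \<mu> $ \<nu> = Im (cnj (pair_coeff (($) r) \<mu>) * pair_coeff (($) r) \<nu>) * overlap (($) r) \<mu> \<nu>"
proof -
  have "mean r (commutator (generator \<mu>) (generator \<nu>)) =
      mean r (\<lambda>\<psi>. generator \<mu> (generator \<nu> \<psi>)) - mean r (\<lambda>\<psi>. generator \<nu> (generator \<mu> \<psi>))"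
    unfolding mean_def probe_eq_squeezed commutator_def[abs_def]
    by (intro fock_inner_diff_right decaying_generator decaying_squeezed)
  then have "mean r (commutator (generator \<mu>) (generator \<nu>)) =
      (cnj (pair_coeff (($) r) \<mu>) * pair_coeff (($) r) \<nu> - cnj (pair_coeff (($) r) \<nu>) * pair_coeff (($) r) \<mu>)
        * complex_of_real (overlap (($) r) \<mu> \<nu>)"
    by (simp add: mean_generator_generator overlap_commute[of _ \<nu> \<mu>] left_diff_distrib)
  moreover have "Re (1 / (2 * \<i>) * z) = Im z / 2" for z by (simp add: Re_divide power2_eq_square)
  ultimately show ?thesis by (simp only: mean_commutator_def vec_lambda_beta) (simp add: field_simps)
qed

text \<open>A beam splitter sends the even squeezed vacuum to odd occupation of \<open>j\<close>, so
  its mean is 0.\<close>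

lemma centred_generator:
  assumes "j \<noteq> k" shows "centred r (generator (j, k)) = generator (j, k)"
  using fock_inner_squeezed_generator[OF assms, of "($) r"]
  unfolding centred_def[abs_def] mean_def probe_eq_squeezed by (intro ext) simp

lemma fisher_entry:
  assumes "j \<noteq> k" "l \<noteq> m"
  shows "fisher r $ (j, k) $ (l, m) =
    4 * Re (cnj (pair_coeff (($) r) (j, k)) * pair_coeff (($) r) (l, m)) * overlap (($) r) (j, k) (l, m)"
proof -
  have "mean r (anticommutator (generator \<mu>) (generator \<nu>)) =
      mean r (\<lambda>\<psi>. generator \<mu> (generator \<nu> \<psi>)) + mean r (\<lambda>\<psi>. generator \<nu> (generator \<mu> \<psi>))" for \<mu> \<nu>
    unfolding mean_def probe_eq_squeezed anticommutator_def[abs_def]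
    by (intro fock_inner_add_right decaying_generator decaying_squeezed)
  then show ?thesis
    by (simp add: fisher_def centred_generator assms mean_generator_generator overlap_commute[of _ "(l, m)" "(j, k)"] algebra_simps
        del: generator.simps)
qed

lemma gram_entry:
  assumes "j \<noteq> k" "l \<noteq> m"
  shows "gram r $ (j, k) $ (l, m) =
    cnj (pair_coeff (($) r) (j, k)) * pair_coeff (($) r) (l, m) * complex_of_real (overlap (($) r) (j, k) (l, m))"
  by (simp add: gram_def centred_generator assms mean_generator_generator del: generator.simps)

text \<open>By parity in every mode, a nonzero entry needs the same pair of modes on both sides, and one of its
  coefficients must be real and the other imaginary.\<close>

lemma mean_commutator_sparse:
  assumes "\<nu> \<noteq> prod.swap \<mu> \<or> fst \<mu> = snd \<mu>" shows "mean_commutator r $ \<mu> $ \<nu> = 0"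
proof (rule ccontr)
  obtain j k l m where \<mu>: "\<mu> = (j, k)" and \<nu>: "\<nu> = (l, m)" by (cases \<mu>, cases \<nu>)
  assume "mean_commutator r $ \<mu> $ \<nu> \<noteq> 0"
  then have ov: "overlap (($) r) (j, k) (l, m) \<noteq> 0"
    and im: "Im (cnj (pair_coeff (($) r) (j, k)) * pair_coeff (($) r) (l, m)) \<noteq> 0"
    unfolding mean_commutator_entry \<mu> \<nu> by auto
  have par: "((i = j) \<noteq> (i = k)) \<longleftrightarrow> ((i = l) \<noteq> (i = m))" for i
    by (rule overlap_nonzero_parity[OF ov])
  have Im0: "Im (pair_coeff (($) r) (a, b)) = 0" if "\<not> b < a" for a b
    using that by (auto simp: pair_coeff_def Let_def)
  have Re0: "Re (pair_coeff (($) r) (a, b)) = 0" if "b < a" for a b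
    using that less_asym[OF that] by (auto simp: pair_coeff_def Let_def)
  from im consider "k < j" "\<not> m < l" | "\<not> k < j" "m < l"
    using Im0[of k j] Im0[of m l] Re0[of k j] Re0[of m l] by force
  then have "l = k \<and> m = j \<and> j \<noteq> k"
  proof cases
    case 1
    then show ?thesis using par[of j] par[of k] by auto
  next
    case 2
    then show ?thesis using par[of l] par[of m] by auto
  qed
  then show False using assms by (simp add: \<mu> \<nu>)
qed

lemma mean_commutator_swap:
  assumes "j < k"
  shows "mean_commutator r $ (j, k) $ (k, j) = ((tanh (r $ j))\<^sup>2 - (tanh (r $ k))\<^sup>2) * overlap (($) r) (j, k) (j, k)"
    and "mean_commutator r $ (k, j) $ (j, k) = - ((tanh (r $ j))\<^sup>2 - (tanh (r $ k))\<^sup>2) * overlap (($) r) (j, k) (j, k)"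
proof -
  have ov: "overlap (($) r) (j, k) (k, j) = overlap (($) r) (j, k) (j, k)"
    "overlap (($) r) (k, j) (j, k) = overlap (($) r) (j, k) (j, k)"
    by (simp_all add: overlap_def pair_state_swap)
  have nlt: "\<not> k < j" "j \<noteq> k" "k \<noteq> j" using assms by auto
  show "mean_commutator r $ (j, k) $ (k, j) = ((tanh (r $ j))\<^sup>2 - (tanh (r $ k))\<^sup>2) * overlap (($) r) (j, k) (j, k)"
    "mean_commutator r $ (k, j) $ (j, k) = - ((tanh (r $ j))\<^sup>2 - (tanh (r $ k))\<^sup>2) * overlap (($) r) (j, k) (j, k)"
    using assms nlt by (simp_all add: mean_commutator_entry ov pair_coeff_def Let_def power2_eq_square algebra_simps)
qed

text \<open>Up to sign and a positive overlap the entry is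
  \<open>(tanh r\<^sub>j)\<^sup>2 - (tanh r\<^sub>k)\<^sup>2\<close>. As \<open>tanh\<close> is odd
  and injective, this vanishes only for \<open>r\<^sub>j = r\<^sub>k\<close> or
  \<open>r\<^sub>j = - r\<^sub>k\<close>, which regularity excludes.\<close>

lemma mean_commutator_nonzero:
  assumes "regular r" "j \<noteq> k" shows "mean_commutator r $ (j, k) $ (k, j) \<noteq> 0"
proof -
  have ne: "(tanh (r $ j))\<^sup>2 \<noteq> (tanh (r $ k))\<^sup>2" if "j < k" for j k
  proof
    assume "(tanh (r $ j))\<^sup>2 = (tanh (r $ k))\<^sup>2"
    then have "tanh (r $ j) = tanh (r $ k) \<or> tanh (r $ j) = tanh (- (r $ k))"
      by (simp add: power2_eq_iff)
    then have "r $ j = r $ k \<or> r $ j = - (r $ k)"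
      using strict_mono_eq[OF tanh_real_strict_mono, of "r $ j"] by blast
    then show False using assms(1) that unfolding regular_def by force
  qed
  from assms(2) consider "j < k" | "k < j" by fastforce
  then show ?thesis
  proof cases
    case 1
    then show ?thesis using ne[OF 1] overlap_pos[of j k "($) r"] assms(2) by (simp add: mean_commutator_swap)
  next
    case 2
    then show ?thesis using ne[OF 2] overlap_pos[of k j "($) r"] assms(2) by (simp add: mean_commutator_swap)
  qed
qed


section \<open>Two-parameter models and isotropic subspaces\<close>

lemma matrix_eq_2: "A = B \<longleftrightarrow> A $ 1 $ 1 = B $ 1 $ 1 \<and> A $ 1 $ 2 = B $ 1 $ 2 \<and> A $ 2 $ 1 = B $ 2 $ 1 \<and> A $ 2 $ 2 = B $ 2 $ 2"
  for A B :: "'a^2^2"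
  by (auto simp: vec_eq_iff forall_2)

lemma matrix_mult_2: "(A ** B) $ i $ j = A $ i $ 1 * B $ 1 $ j + A $ i $ 2 * B $ 2 $ j"
  for A B :: "'a::semiring_1^2^2"
  by (simp add: matrix_matrix_mult_def sum_2)

lemma rank_one_2:
  fixes G :: "complex^2^2"
  assumes "G $ 1 $ 1 \<noteq> 0" and det: "G $ 1 $ 1 * G $ 2 $ 2 = G $ 1 $ 2 * G $ 2 $ 1"
  shows "rank G = 1"
proof -
  define c where "c = G $ 2 $ 1 / G $ 1 $ 1"
  have r2: "row 2 G = c *s row 1 G"
    using assms by (simp add: vec_eq_iff forall_2 row_def c_def field_simps)
  have rows: "rows G = {row 1 G, row 2 G}" by (auto simp: rows_def) (metis exhaust_2)
  have ne: "row 1 G \<noteq> 0" using assms(1) by (auto simp: vec_eq_iff row_def)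
  have "vec.dim (rows G) = card {row 1 G}"
  proof (rule vec.dim_unique)
    show "rows G \<subseteq> vec.span {row 1 G}"
      unfolding rows r2 by (auto intro: vec.span_base vec.span_scale)
    show "vec.independent {row 1 G}" using ne by (simp add: vec.dependent_single)
  qed (auto simp: rows)
  then show ?thesis by (simp add: row_rank_def_gen)
qed

text \<open>\<open>matrix_inv\<close> is a choice among two-sided inverses, so uniqueness of the
  inverse determines it.\<close>

lemma matrix_inv_eqI:
  fixes A B :: "'a::semiring_1^'n^'n"
  assumes "A ** B = mat 1" "B ** A = mat 1"
  shows "matrix_inv A = B"
proof -
  have "A ** matrix_inv A = mat 1 \<and> matrix_inv A ** A = mat 1"
    unfolding matrix_inv_def by (rule someI[of _ B]) (use assms in blast)
  then have "B ** A ** matrix_inv A = B" by (simp add: matrix_mul_assoc[symmetric])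
  then show ?thesis by (simp add: assms(2))
qed

definition diag2 :: "real \<Rightarrow> real \<Rightarrow> real^2^2" where
  "diag2 p q = (\<chi> a b. if a = b then if a = 1 then p else q else 0)"

lemma diag2_entries [simp]:
  "diag2 p q $ 1 $ 1 = p" "diag2 p q $ 2 $ 2 = q" "diag2 p q $ 1 $ 2 = 0" "diag2 p q $ 2 $ 1 = 0"
  by (simp_all add: diag2_def)

lemma inv_sqrt_diag2:
  assumes p: "0 < p" and q: "0 < q"
  shows "inv_sqrt (diag2 p q) = diag2 (1 / sqrt p) (1 / sqrt q)"
proof -
  have inv: "matrix_inv (diag2 p q) = diag2 (1 / p) (1 / q)"
    using p q by (intro matrix_inv_eqI) (simp_all add: matrix_eq_2 matrix_mult_2 mat_def)
  have quad: "x \<bullet> (S *v x) = x $ 1 * (S $ 1 $ 1 * x $ 1 + S $ 1 $ 2 * x $ 2) + x $ 2 * (S $ 2 $ 1 * x $ 1 + S $ 2 $ 2 * x $ 2)"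
    for S :: "real^2^2" and x
    by (simp add: inner_vec_def matrix_vector_mult_def sum_2)
  show ?thesis
    unfolding inv_sqrt_def inv
  proof (rule the_equality)
    have "0 < x \<bullet> (diag2 (1 / sqrt p) (1 / sqrt q) *v x)" if "x \<noteq> 0" for x
    proof -
      have "x \<bullet> (diag2 (1 / sqrt p) (1 / sqrt q) *v x) = (x $ 1)\<^sup>2 / sqrt p + (x $ 2)\<^sup>2 / sqrt q"
        by (simp add: quad power2_eq_square)
      moreover have "0 < (x $ 1)\<^sup>2 / sqrt p \<or> 0 < (x $ 2)\<^sup>2 / sqrt q"
        using that p q by (auto simp: vec_eq_iff forall_2)
      moreover have "0 \<le> (x $ 1)\<^sup>2 / sqrt p" "0 \<le> (x $ 2)\<^sup>2 / sqrt q" using p q by auto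
      ultimately show ?thesis by linarith
    qed
    then show "pos_def (diag2 (1 / sqrt p) (1 / sqrt q)) \<and>
        diag2 (1 / sqrt p) (1 / sqrt q) ** diag2 (1 / sqrt p) (1 / sqrt q) = diag2 (1 / p) (1 / q)"
      using p q by (simp add: pos_def_def matrix_eq_2 matrix_mult_2 transpose_def)
  next
    fix S assume S: "pos_def S \<and> S ** S = diag2 (1 / p) (1 / q)"
    then have "transpose S = S" and pd: "\<And>x. x \<noteq> 0 \<Longrightarrow> 0 < x \<bullet> (S *v x)"
      and SS: "S ** S = diag2 (1 / p) (1 / q)" unfolding pos_def_def by blast+
    then have "transpose S $ 1 $ 2 = S $ 1 $ 2" by simp
    then have sym: "S $ 2 $ 1 = S $ 1 $ 2" by (simp add: transpose_def)
    have "axis i 1 \<noteq> (0 :: real^2)" for i by (simp add: axis_eq_0_iff)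
    then have "0 < axis i 1 \<bullet> (S *v axis i 1)" for i by (rule pd)
    from this[of 1] this[of 2] have pos: "0 < S $ 1 $ 1" "0 < S $ 2 $ 2" by (simp_all add: quad axis_def)
    have sq: "S $ 1 $ 1 * S $ 1 $ 1 + S $ 1 $ 2 * S $ 1 $ 2 = 1 / p"
        "S $ 1 $ 1 * S $ 1 $ 2 + S $ 1 $ 2 * S $ 2 $ 2 = 0"
        "S $ 1 $ 2 * S $ 1 $ 2 + S $ 2 $ 2 * S $ 2 $ 2 = 1 / q"
      using SS by (simp_all add: matrix_eq_2 matrix_mult_2 sym)
    \<comment> \<open>The trace of a positive definite matrix is positive, so its off-diagonal entry
      must vanish when its square is diagonal. This settles the uniqueness demanded by
      \<open>THE\<close>.\<close>
    have "S $ 1 $ 2 * (S $ 1 $ 1 + S $ 2 $ 2) = 0" using sq(2) by (simp add: algebra_simps)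
    then have off: "S $ 1 $ 2 = 0" using pos by simp
    have "S $ 1 $ 1 = 1 / sqrt p"
      using sq(1) pos(1) off real_sqrt_unique[of "S $ 1 $ 1" "1 / p"] by (simp add: power2_eq_square real_sqrt_divide)
    moreover have "S $ 2 $ 2 = 1 / sqrt q"
      using sq(3) pos(2) off real_sqrt_unique[of "S $ 2 $ 2" "1 / q"] by (simp add: power2_eq_square real_sqrt_divide)
    ultimately show "S = diag2 (1 / sqrt p) (1 / sqrt q)" by (simp add: matrix_eq_2 sym off)
  qed
qed

text \<open>\<open>sat\<close> says that \<open>F / 4 + \<i> C\<close> has determinant 0, that is,
  the uncertainty bound is attained. The normalised matrix is then antisymmetric with off-diagonal
  entries of modulus 1, so \<i> times it exchanges the coordinates up to phases and is an
  isometry.\<close>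

lemma incompatibility_one_2:
  fixes F C :: "real^2^2"
  assumes F: "0 < F $ 1 $ 1" "0 < F $ 2 $ 2" "F $ 1 $ 2 = 0" "F $ 2 $ 1 = 0"
    and C: "C $ 1 $ 1 = 0" "C $ 2 $ 2 = 0" "C $ 2 $ 1 = - C $ 1 $ 2"
    and sat: "16 * (C $ 1 $ 2)\<^sup>2 = F $ 1 $ 1 * F $ 2 $ 2"
  shows "incompatibility F C = 1"
proof -
  define p q c where "p = F $ 1 $ 1" and "q = F $ 2 $ 2" and "c = 4 * C $ 1 $ 2 / (sqrt p * sqrt q)"
  have pq: "0 < p" "0 < q" using F by (auto simp: p_def q_def)
  have "F = diag2 p q" using F by (simp add: matrix_eq_2 p_def q_def)
  then have M: "inv_sqrt F = diag2 (1 / sqrt p) (1 / sqrt q)" using inv_sqrt_diag2[OF pq] by simp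
  define M where "M = inv_sqrt F ** (4 *\<^sub>R C) ** inv_sqrt F"
  have ent: "M $ 1 $ 1 = 0" "M $ 2 $ 2 = 0" "M $ 1 $ 2 = c" "M $ 2 $ 1 = - c"
    unfolding M_def M using C by (simp_all add: matrix_mult_2 c_def)
  have "c\<^sup>2 = 16 * (C $ 1 $ 2)\<^sup>2 / (p * q)"
    using pq by (simp add: c_def power_divide power_mult_distrib)
  then have c2: "c\<^sup>2 = 1" using sat pq by (simp add: p_def q_def)
  define T where "T = (\<lambda>v :: complex^2. (\<chi> a b. \<i> * complex_of_real (M $ a $ b)) *v v)"
  have "norm (T v) = norm v" for v
  proof -
    have "T v $ 1 = \<i> * complex_of_real c * v $ 2" "T v $ 2 = - (\<i> * complex_of_real c * v $ 1)"
      unfolding T_def by (simp_all add: matrix_vector_mult_def sum_2 ent)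
    then show ?thesis
      by (simp add: norm_vec_def L2_set_def sum_2 norm_mult power_mult_distrib c2 add.commute)
  qed
  \<comment> \<open>\<open>onorm\<close> depends only on the norms of the images, so
    \<open>T\<close> has the operator norm of the identity.\<close>
  then have "onorm T = 1" using onorm_id unfolding onorm_def by simp
  then show ?thesis by (simp add: incompatibility_def M_def T_def)
qed

section \<open>Maximal isotropic subspaces\<close>

lemma card_ordered_pairs:
  "card {\<mu> :: 'n::{finite,linorder} \<times> 'n. fst \<mu> \<le> snd \<mu>} = CARD('n) * (CARD('n) + 1) div 2"
proof -
  define L where "L = {\<mu> :: 'n \<times> 'n. fst \<mu> < snd \<mu>}"
  define D where "D = {\<mu> :: 'n \<times> 'n. fst \<mu> = snd \<mu>}"
  have "card (prod.swap ` L) = card L" by (intro card_image) (auto simp: inj_on_def)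
  moreover have "D = (\<lambda>j. (j, j)) ` UNIV" by (auto simp: D_def)
  then have "card D = CARD('n)" by (simp add: card_image inj_on_def)
  moreover have "UNIV = L \<union> D \<union> prod.swap ` L"
  proof (intro equalityI subsetI)
    fix \<mu> :: "'n \<times> 'n"
    obtain j k where \<mu>: "\<mu> = (j, k)" by (cases \<mu>)
    show "\<mu> \<in> L \<union> D \<union> prod.swap ` L"
      by (cases j k rule: linorder_cases) (auto simp: \<mu> L_def D_def image_iff)
  qed simp
  then have "card (UNIV :: ('n \<times> 'n) set) = card (L \<union> D \<union> prod.swap ` L)" by (rule arg_cong)
  moreover have "card (L \<union> D \<union> prod.swap ` L) = card (L \<union> D) + card (prod.swap ` L)"
    by (rule card_Un_disjoint) (auto simp: L_def D_def)
  moreover have "card (L \<union> D) = card L + card D"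
    by (rule card_Un_disjoint) (auto simp: L_def D_def)
  moreover have "{\<mu> :: 'n \<times> 'n. fst \<mu> \<le> snd \<mu>} = L \<union> D" by (auto simp: L_def D_def)
  ultimately show ?thesis by (simp add: card_cartesian_product)
qed

text \<open>The form is a direct sum of nondegenerate \<open>2\<times>2\<close> blocks and an \<open>n\<close>-dimensional kernel.\<close>

locale swap_form =
  fixes C :: "real^('n::{finite,linorder} \<times> 'n)^('n \<times> 'n)"
  assumes sparse: "\<nu> \<noteq> prod.swap \<mu> \<or> fst \<mu> = snd \<mu> \<Longrightarrow> C $ \<mu> $ \<nu> = 0"
    and nondegenerate: "j \<noteq> k \<Longrightarrow> C $ (j, k) $ (k, j) \<noteq> 0"
begin

lemma mult_vec: "(C *v v) $ \<mu> = C $ \<mu> $ prod.swap \<mu> * v $ prod.swap \<mu>"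
proof -
  have "(C *v v) $ \<mu> = (\<Sum>\<nu>\<in>UNIV. if \<nu> = prod.swap \<mu> then C $ \<mu> $ \<nu> * v $ \<nu> else 0)"
    unfolding matrix_vector_mult_def vec_lambda_beta by (intro sum.cong refl) (simp add: sparse)
  then show ?thesis by simp
qed

lemma isotropic_exists:
  obtains V where "subspace V" "\<forall>u\<in>V. \<forall>v\<in>V. u \<bullet> (C *v v) = 0" "dim V = CARD('n) * (CARD('n) + 1) div 2"
proof
  \<comment> \<open>The rotations and all X beam splitters: the whole kernel and one index from each
    swapped pair.\<close>
  define d where "d = {\<mu> :: 'n \<times> 'n. fst \<mu> \<le> snd \<mu>}"
  define V where "V = {x :: real^('n \<times> 'n). \<forall>\<mu>. \<mu> \<notin> d \<longrightarrow> x $ \<mu> = 0}"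
  show "subspace V" by (auto simp: V_def subspace_def)
  show "dim V = CARD('n) * (CARD('n) + 1) div 2"
    using dim_substandard_cart[of d, where 'a = real] card_ordered_pairs[where 'n = 'n]
    by (simp add: V_def d_def dim_vec_eq)
  show "\<forall>u\<in>V. \<forall>v\<in>V. u \<bullet> (C *v v) = 0"
  proof (intro ballI)
    fix u v assume uv: "u \<in> V" "v \<in> V"
    have "u $ \<mu> * (C *v v) $ \<mu> = 0" for \<mu>
    proof (cases "fst \<mu> = snd \<mu>")
      case False
      then have "\<mu> \<notin> d \<or> prod.swap \<mu> \<notin> d" by (auto simp: d_def)
      then have "u $ \<mu> = 0 \<or> v $ prod.swap \<mu> = 0" using uv unfolding V_def by blast
      then show ?thesis by (auto simp: mult_vec)
    qed (simp add: mult_vec sparse)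
    then show "u \<bullet> (C *v v) = 0" unfolding inner_vec_def inner_real_def by (intro sum.neutral ballI)
  qed
qed

text \<open>\<open>C\<close> maps \<open>V \<inter> W\<close>, where \<open>W\<close> is a complement of the kernel, injectively into the orthogonal complement of \<open>V\<close>.\<close>

lemma isotropic_dim_le:
  assumes V: "subspace V" and iso: "\<forall>u\<in>V. \<forall>v\<in>V. u \<bullet> (C *v v) = 0"
  shows "dim V \<le> CARD('n) * (CARD('n) + 1) div 2"
proof -
  define d where "d = {\<mu> :: 'n \<times> 'n. fst \<mu> \<noteq> snd \<mu>}"
  define W where "W = {x :: real^('n \<times> 'n). \<forall>\<mu>. \<mu> \<notin> d \<longrightarrow> x $ \<mu> = 0}"
  have W: "subspace W" by (auto simp: W_def subspace_def)
  have VW: "subspace (V \<inter> W)" using V W by (rule subspace_inter)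
  have "- d = (\<lambda>j. (j, j)) ` UNIV" by (auto simp: d_def)
  then have "card (- d) = CARD('n)" by (simp add: card_image inj_on_def)
  moreover have "card d + card (- d) = CARD('n) * CARD('n)"
    using card_Un_disjoint[of d "- d"] by (simp add: Compl_partition card_cartesian_product)
  moreover have "dim W = card d"
    using dim_substandard_cart[of d, where 'a = real] by (simp add: W_def dim_vec_eq)
  ultimately have dW: "dim W + CARD('n) = CARD('n) * CARD('n)" by simp
  have full: "DIM(real^('n \<times> 'n)) = CARD('n) * CARD('n)" by simp
  have "dim {x + y |x y. x \<in> V \<and> y \<in> W} \<le> CARD('n) * CARD('n)"
    using dim_subset_UNIV[of "{x + y |x y. x \<in> V \<and> y \<in> W}"] by simp
  \<comment> \<open>\<open>W\<close> has codimension \<open>CARD('n)\<close>, so intersecting with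
    it costs at most that many dimensions.\<close>
  then have dVW: "dim V \<le> dim (V \<inter> W) + CARD('n)"
    using dim_sums_Int[OF V W] dW by linarith
  have inj: "inj_on ((*v) C) (span (V \<inter> W))"
  proof (rule inj_onI)
    fix x y assume "x \<in> span (V \<inter> W)" "y \<in> span (V \<inter> W)" and eq: "C *v x = C *v y"
    then have xy: "x \<in> W" "y \<in> W" using span_eq_iff[THEN iffD2, OF VW] by auto
    show "x = y"
    proof (rule vec_eq_iff[THEN iffD2], rule allI)
      fix \<mu> :: "'n \<times> 'n"
      obtain j k where \<mu>: "\<mu> = (j, k)" by (cases \<mu>)
      show "x $ \<mu> = y $ \<mu>"
      proof (cases "j = k")
        case True
        then show ?thesis using xy by (simp add: W_def d_def \<mu>)
      next
        case False
        have "(C *v x) $ (k, j) = (C *v y) $ (k, j)" by (simp add: eq)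
        then show ?thesis using nondegenerate[of k j] False by (simp add: mult_vec \<mu>)
      qed
    qed
  qed
  have "dim ((*v) C ` (V \<inter> W)) = dim (V \<inter> W)"
    by (rule dim_image_eq[OF matrix_vector_mul_linear inj])
  moreover have "dim ((*v) C ` (V \<inter> W)) \<le> dim {y \<in> UNIV. \<forall>x\<in>V. orthogonal x y}"
    using iso by (intro dim_subset) (auto simp: orthogonal_def)
  moreover have "dim {y \<in> UNIV. \<forall>x\<in>V. orthogonal x y} + dim V = CARD('n) * CARD('n)"
    using dim_subspace_orthogonal_to_vectors[OF V subspace_UNIV] by (simp add: dim_UNIV)
  \<comment> \<open>With \<open>n = CARD('n)\<close>, this adds
    \<open>dim V \<le> dim (V \<inter> W) + n\<close> and
    \<open>dim (V \<inter> W) + dim V \<le> n\<^sup>2\<close>.\<close>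
  ultimately have "2 * dim V \<le> CARD('n) * (CARD('n) + 1)" using dVW by simp
  then show ?thesis by linarith
qed

end

theorem propositionS26:
  fixes r :: "real^'n::{finite,linorder}"
  shows "(\<forall>j k. j < k \<longrightarrow> fisher r $ (j, k) $ (j, k) > 0 \<longrightarrow> fisher r $ (k, j) $ (k, j) > 0 \<longrightarrow>
            rank (submodel (bs_pair j k) (gram r)) = 1 \<and>
            incompatibility (submodel (bs_pair j k) (fisher r))
                            (submodel (bs_pair j k) (mean_commutator r)) = 1) \<and>
         (regular r \<longrightarrow>
            (\<exists>V. subspace V \<and> compatible r V \<and> dim V = CARD('n) * (CARD('n) + 1) div 2) \<and>
            (\<forall>V. subspace V \<and> compatible r V \<longrightarrow> dim V \<le> CARD('n) * (CARD('n) + 1) div 2))"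
proof (intro conjI impI allI)
  fix j k :: 'n
  assume jk: "j < k" and FX: "fisher r $ (j, k) $ (j, k) > 0" and FY: "fisher r $ (k, j) $ (k, j) > 0"
  define N where "N = overlap (($) r) (j, k) (j, k)"
  \<comment> \<open>Up to phases, the factors with which X and Y act; the sign of \<open>b\<close>
    follows the index order \<open>(k, j)\<close>. Positivity of the two Fisher entries amounts to
    \<open>a\<close> and \<open>b\<close> being nonzero.\<close>
  define a b where "a = tanh (r $ j) + tanh (r $ k)" and "b = tanh (r $ k) - tanh (r $ j)"
  have ne: "j \<noteq> k" "k \<noteq> j" "\<not> k < j" using jk by auto
  have N: "0 < N" using overlap_pos[OF ne(1)] by (simp add: N_def)
  have ov: "overlap (($) r) \<mu> \<nu> = N" if "\<mu> \<in> {(j, k), (k, j)}" "\<nu> \<in> {(j, k), (k, j)}" for \<mu> \<nu>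
    using that by (auto simp: overlap_def N_def pair_state_swap[of _ k j])
  have coeff: "pair_coeff (($) r) (j, k) = - complex_of_real a" "pair_coeff (($) r) (k, j) = \<i> * complex_of_real b"
    using jk ne by (simp_all add: pair_coeff_def Let_def a_def b_def)
  have bs: "bs_pair j k 1 = (j, k)" "bs_pair j k 2 = (k, j)" by (simp_all add: bs_pair_def)
  \<comment> \<open>The mixed entries vanish because the product of a real and an imaginary
    coefficient has real part 0.\<close>
  have F: "fisher r $ (j, k) $ (j, k) = 4 * a\<^sup>2 * N" "fisher r $ (k, j) $ (k, j) = 4 * b\<^sup>2 * N"
    "fisher r $ (j, k) $ (k, j) = 0" "fisher r $ (k, j) $ (j, k) = 0"
    using ne by (simp_all add: fisher_entry coeff ov power2_eq_square)
  have ab: "a \<noteq> 0" "b \<noteq> 0" using FX FY by (auto simp: F)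
  have G: "gram r $ (j, k) $ (j, k) = complex_of_real (a\<^sup>2 * N)" "gram r $ (k, j) $ (k, j) = complex_of_real (b\<^sup>2 * N)"
    "gram r $ (j, k) $ (k, j) = - \<i> * complex_of_real (a * b * N)" "gram r $ (k, j) $ (j, k) = \<i> * complex_of_real (a * b * N)"
    using ne by (simp_all add: gram_entry coeff ov power2_eq_square complex_eq_iff)
  have C: "mean_commutator r $ (j, k) $ (k, j) = - (a * b * N)" "mean_commutator r $ (k, j) $ (j, k) = a * b * N"
    "mean_commutator r $ (j, k) $ (j, k) = 0" "mean_commutator r $ (k, j) $ (k, j) = 0"
    by (simp_all add: mean_commutator_entry coeff ov)
  \<comment> \<open>The products of the diagonal and of the off-diagonal entries are both
    \<open>(a b N)\<^sup>2\<close>.\<close>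
  show "rank (submodel (bs_pair j k) (gram r)) = 1"
    using ab N by (intro rank_one_2) (simp_all add: submodel_def bs G power2_eq_square complex_eq_iff)
  show "incompatibility (submodel (bs_pair j k) (fisher r)) (submodel (bs_pair j k) (mean_commutator r)) = 1"
  proof (rule incompatibility_one_2)
    show "0 < submodel (bs_pair j k) (fisher r) $ 1 $ 1" "0 < submodel (bs_pair j k) (fisher r) $ 2 $ 2"
      using FX FY by (simp_all add: submodel_def bs)
  qed (simp_all add: submodel_def bs F C power2_eq_square)
next
  assume "regular r"
  then interpret swap_form "mean_commutator r"
    by unfold_locales (rule mean_commutator_sparse mean_commutator_nonzero, assumption+)+
  show "\<exists>V. subspace V \<and> compatible r V \<and> dim V = CARD('n) * (CARD('n) + 1) div 2"
    using isotropic_exists unfolding compatible_def by metis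
  show "dim V \<le> CARD('n) * (CARD('n) + 1) div 2" if "subspace V \<and> compatible r V" for V
    using that unfolding compatible_def by (elim conjE) (rule isotropic_dim_le)
qed

end
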